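(* Let $r\ge2$ and $k\in\mathbb{Z}$. The Hecke operators $\mathcal{T}_N$ ($0\ne N\in A$) act completely multiplicatively on Drinfeld modular forms of weight $k$ for $GL_r(A)$: for all nonzero $M,N\in A$ and every such modular form $f$, $\mathcal{T}_M(\mathcal{T}_Nf)=\mathcal{T}_{MN}f$. In particular, for irreducible $p$ and $n\ge1$, $\mathcal{T}_{p^n}=(\mathcal{T}_p)^n$ as operators on these modular forms.
   Context: Let $\mathbb{F}_q$ be a finite field with $q$ elements, $A=\mathbb{F}_q[t]$, $F=\mathbb{F}_q(t)$, $F_\infty=\mathbb{F}_q((t^{-1}))$, $\mathbb{C}_\infty$ the completion of an algebraic closure of $F_\infty$ (a field of characteristic $\mathrm{char}\,\mathbb{F}_q$). $\Omega^r\subset\mathbb{P}^{r-1}(\mathbb{C}_\infty)$ is the complement of all $F_\infty$-rational hyperplanes; points are column vectors $\omega=(\omega_1,\dots,\omega_{r-1},1)^T$ with $F_\infty$-linearly independent entries. For $\gamma\in GL_r(F)$, $j(\gamma,\omega)$ is the last entry of $\gamma\omega$, $\gamma(\omega)=j(\gamma,\omega)^{-1}\gamma\omega$, $(f|_k\gamma)(\omega)=j(\gamma,\omega)^{-k}f(\gamma(\omega))$. A Drinfeld modular form of weight $k$ for $\Gamma=GL_r(A)$ is a rigid analytic $f:\Omega^r\to\mathbb{C}_\infty$ with $f|_k\gamma=f$ for all $\gamma\in\Gamma$ whose $u$-expansion $f(\omega)=\sum_nf_n(\omega_2,\dots,\omega_r)u^n$, $u=e_{A\omega_2+\dots+A\omega_r}(\omega_1)^{-1}$,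 $e_L(X)=X\prod_{0\ne\lambda\in L}(1-X/\lambda)$, has $f_n=0$ for $n<0$. Let $S$ be the set of $r\times r$ matrices over $A$ with nonzero determinant. A double coset $\Gamma\alpha\Gamma=\bigsqcup_i\Gamma\alpha_i$ ($\alpha\in S$) acts on modular forms of weight $k$ by $f\mapsto\sum_if|_k\alpha_i$, extended additively. For $0\ne N\in A$, $\mathcal{T}_N$ is the sum of all distinct double cosets $\Gamma\alpha\Gamma$ with $\alpha\in S$ and $\det\alpha\in N\mathbb{F}_q^\times$. *)

theory Defs
  imports
    "HOL-Analysis.Uniform_Limit"
    "HOL-Library.Cardinality"
    "HOL-Computational_Algebra.Formal_Laurent_Series"
    "HOL-Algebra.Algebraic_Closure_Type"
    "Jordan_Normal_Form.Determinant"
begin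

text \<open>
  Conventions. \<open>'q\<close> is the finite field with \<open>q\<close> elements; \<open>A\<close> is the type \<open>'q poly\<close>; the completion
  of the field of rational functions at infinity is the type \<open>'q fls\<close> of formal Laurent series, where
  the series variable \<open>fls_X\<close> is \<open>1/t\<close>, so that \<open>t\<close> is \<open>fls_X_inv\<close>.
  Indices of vectors and matrices start at 0: the entries of \<open>\<omega>\<close>, written
  \<open>(\<omega>\<^sub>1, \<dots>, \<omega>\<^sub>r)\<close> on paper, are \<open>\<omega> $ 0, \<dots>, \<omega> $ (r - 1)\<close>.
  Functions on the Drinfeld symmetric space are total functions on vectors, whose values outside of
  that space are irrelevant.
\<close>


subsection \<open>The field \<open>\<complex>\<^sub>\<infinity>\<close>\<close>

definition vabs :: "'c::{field, metric_space} \<Rightarrow> real" where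
  "vabs x = dist x 0"

definition fls_abs :: "'q::{finite, field} fls \<Rightarrow> real" where
  "fls_abs x = (if x = 0 then 0 else real CARD('q) powi (- fls_subdegree x))"

text \<open>
  The pair of \<open>'c\<close> and \<open>\<iota>\<close> is a completion of an algebraic closure of \<open>'q fls\<close>: the distance of \<open>'c\<close>
  comes from a non-archimedean absolute value, which extends the one of \<open>'q fls\<close> (and hence induces on
  the algebraic closure the unique extension), and the image of the algebraic closure is dense.
  Completeness is part of the type class of \<open>'c\<close>.
\<close>
definition C_infinity :: "('q::{finite, field} fls alg_closure \<Rightarrow> 'c::{field, complete_space}) \<Rightarrow> bool" where
  "C_infinity \<iota> \<longleftrightarrow>
     field_hom \<iota> \<and>
     (\<forall>x y::'c. dist x y = vabs (x - y)) \<and>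
     (\<forall>x y::'c. vabs (x * y) = vabs x * vabs y) \<and>
     (\<forall>x y::'c. vabs (x + y) \<le> max (vabs x) (vabs y)) \<and>
     (\<forall>x. vabs (\<iota> (to_ac x)) = fls_abs x) \<and>
     closure (range \<iota>) = (UNIV :: 'c set)"

definition emb_inf :: "('q::{finite, field} fls alg_closure \<Rightarrow> 'c::{field, complete_space}) \<Rightarrow> 'q fls \<Rightarrow> 'c" where
  "emb_inf \<iota> x = \<iota> (to_ac x)"

definition emb_A :: "('q::{finite, field} fls alg_closure \<Rightarrow> 'c::{field, complete_space}) \<Rightarrow> 'q poly \<Rightarrow> 'c" where
  "emb_A \<iota> a = emb_inf \<iota> (poly (map_poly fls_const a) fls_X_inv)"


subsection \<open>The Drinfeld symmetric space and rigid analytic functions\<close>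

definition Omega :: "('q::{finite, field} fls alg_closure \<Rightarrow> 'c::{field, complete_space}) \<Rightarrow> nat \<Rightarrow> 'c vec set" where
  "Omega \<iota> r = {\<omega> \<in> carrier_vec r. \<omega> $ (r - 1) = 1 \<and>
     (\<forall>c. (\<Sum>i<r. emb_inf \<iota> (c i) * \<omega> $ i) = 0 \<longrightarrow> (\<forall>i<r. c i = 0))}"

text \<open>
  The standard exhaustion of the Drinfeld symmetric space by affinoids: the points with
  \<open>\<bar>\<ell>(\<omega>)\<bar> \<ge> q\<^sup>-\<^sup>n \<cdot> \<bar>\<ell>\<bar> \<cdot> \<bar>\<omega>\<bar>\<close> for all linear forms \<open>\<ell>\<close> with coefficients \<open>c\<close> in \<open>'q fls\<close>, where
  \<open>\<bar>\<ell>\<bar>\<close> and \<open>\<bar>\<omega>\<bar>\<close> denote the maximum norms.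
\<close>
definition Omega_aff :: "('q::{finite, field} fls alg_closure \<Rightarrow> 'c::{field, complete_space}) \<Rightarrow> nat \<Rightarrow> nat \<Rightarrow> 'c vec set" where
  "Omega_aff \<iota> r n = {\<omega> \<in> Omega \<iota> r. \<forall>c. \<forall>i<r. \<forall>j<r.
     fls_abs (c i) * vabs (\<omega> $ j)
       \<le> real CARD('q) ^ n * vabs (\<Sum>l<r. emb_inf \<iota> (c l) * \<omega> $ l)}"

text \<open>Polynomial functions in \<open>r\<close> variables; \<open>m\<close> ranges over the exponent vectors of the monomials.\<close>
definition poly_fun :: "nat \<Rightarrow> ('c::comm_ring_1 vec \<Rightarrow> 'c) \<Rightarrow> bool" where
  "poly_fun r P \<longleftrightarrow> (\<exists>(I :: (nat \<Rightarrow> nat) set) a. finite I \<and>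
     P = (\<lambda>\<omega>. \<Sum>m\<in>I. a m * (\<Prod>i<r. (\<omega> $ i) ^ m i)))"

definition regular_on :: "nat \<Rightarrow> 'c::field vec set \<Rightarrow> ('c vec \<Rightarrow> 'c) \<Rightarrow> bool" where
  "regular_on r U g \<longleftrightarrow> (\<exists>num den. poly_fun r num \<and> poly_fun r den \<and>
     (\<forall>\<omega>\<in>U. den \<omega> \<noteq> 0 \<and> g \<omega> = num \<omega> / den \<omega>))"

text \<open>
  The affinoid algebra of each \<open>Omega_aff \<iota> r n\<close> is the completion, in the supremum norm, of the ring
  of rational functions without poles on it (\<open>Omega_aff \<iota> r n\<close> is a rational subdomain of a polydisc).
  A function is rigid analytic iff its restriction to each of these affinoids, which form an
  admissible covering, lies in the affinoid algebra.
\<close>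
definition rigid_analytic :: "('q::{finite, field} fls alg_closure \<Rightarrow> 'c::{field, complete_space}) \<Rightarrow> nat \<Rightarrow> ('c vec \<Rightarrow> 'c) \<Rightarrow> bool" where
  "rigid_analytic \<iota> r f \<longleftrightarrow> (\<forall>n. \<exists>g :: nat \<Rightarrow> 'c vec \<Rightarrow> 'c.
     (\<forall>m. regular_on r (Omega_aff \<iota> r n) (g m)) \<and>
     uniform_limit (Omega_aff \<iota> r n) g f sequentially)"


subsection \<open>The slash operation\<close>

text \<open>
  The matrix \<open>\<gamma>\<close> has entries in \<open>'c\<close>; it is applied below to matrices over \<open>A\<close> mapped into \<open>'c\<close>.
\<close>
definition aut_factor :: "nat \<Rightarrow> 'c::field mat \<Rightarrow> 'c vec \<Rightarrow> 'c" where
  "aut_factor r \<gamma> \<omega> = (\<gamma> *\<^sub>v \<omega>) $ (r - 1)"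

definition moebius_act :: "nat \<Rightarrow> 'c::field mat \<Rightarrow> 'c vec \<Rightarrow> 'c vec" where
  "moebius_act r \<gamma> \<omega> = inverse (aut_factor r \<gamma> \<omega>) \<cdot>\<^sub>v (\<gamma> *\<^sub>v \<omega>)"

definition slash :: "nat \<Rightarrow> int \<Rightarrow> ('c::field vec \<Rightarrow> 'c) \<Rightarrow> 'c mat \<Rightarrow> 'c vec \<Rightarrow> 'c" where
  "slash r k f \<gamma> \<omega> = aut_factor r \<gamma> \<omega> powi (- k) * f (moebius_act r \<gamma> \<omega>)"

definition GL_A :: "nat \<Rightarrow> 'q::{finite, field} poly mat set" where
  "GL_A r = {\<gamma> \<in> carrier_mat r r. invertible_mat \<gamma>}"


subsection \<open>Drinfeld modular forms\<close>

definition tail_vec :: "'c vec \<Rightarrow> 'c vec" where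
  "tail_vec \<omega> = vec (dim_vec \<omega> - 1) (\<lambda>i. \<omega> $ Suc i)"

definition A_span :: "('q::{finite, field} fls alg_closure \<Rightarrow> 'c::{field, complete_space}) \<Rightarrow> 'c vec \<Rightarrow> 'c set" where
  "A_span \<iota> v = {\<Sum>i<dim_vec v. emb_A \<iota> (a i) * v $ i | a :: nat \<Rightarrow> 'q poly. True}"

text \<open>The product is the limit of the finite partial products.\<close>
definition lattice_exp :: "'c::{field, complete_space} set \<Rightarrow> 'c \<Rightarrow> 'c" where
  "lattice_exp L z = z * Lim (finite_subsets_at_top (L - {0})) (\<lambda>S. \<Prod>l\<in>S. 1 - z / l)"

definition u_param :: "('q::{finite, field} fls alg_closure \<Rightarrow> 'c::{field, complete_space}) \<Rightarrow> 'c vec \<Rightarrow> 'c" where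
  "u_param \<iota> \<omega> = inverse (lattice_exp (A_span \<iota> (tail_vec \<omega>)) (\<omega> $ 0))"

text \<open>
  A \<open>u\<close>-expansion has rigid analytic coefficients and is valid on a neighbourhood of infinity,
  not on the whole space: for each \<open>n\<close> there is an \<open>R\<close> such that it converges to \<open>f\<close> at all \<open>\<omega>\<close> whose
  tail lies in the \<open>n\<close>-th affinoid in dimension \<open>r - 1\<close> and whose first entry has distance at
  least \<open>R\<close> from the \<open>'q fls\<close>-span of the remaining entries.
\<close>
definition u_expansion :: "('q::{finite, field} fls alg_closure \<Rightarrow> 'c::{field, complete_space}) \<Rightarrow> nat \<Rightarrow>
    ('c vec \<Rightarrow> 'c) \<Rightarrow> (int \<Rightarrow> 'c vec \<Rightarrow> 'c) \<Rightarrow> bool" where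
  "u_expansion \<iota> r f c \<longleftrightarrow>
     (\<forall>n. rigid_analytic \<iota> (r - 1) (c n)) \<and>
     (\<forall>n. \<exists>R>0. \<forall>\<omega>\<in>Omega \<iota> r.
        tail_vec \<omega> \<in> Omega_aff \<iota> (r - 1) n \<longrightarrow>
        (\<forall>b. vabs (\<omega> $ 0 - (\<Sum>i<r - 1. emb_inf \<iota> (b i) * tail_vec \<omega> $ i)) \<ge> R) \<longrightarrow>
        ((\<lambda>m. c m (tail_vec \<omega>) * u_param \<iota> \<omega> powi m) has_sum f \<omega>) UNIV)"

definition drinfeld_modular_form :: "('q::{finite, field} fls alg_closure \<Rightarrow> 'c::{field, complete_space}) \<Rightarrow> nat \<Rightarrow>
    int \<Rightarrow> ('c vec \<Rightarrow> 'c) \<Rightarrow> bool" where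
  "drinfeld_modular_form \<iota> r k f \<longleftrightarrow>
     rigid_analytic \<iota> r f \<and>
     (\<forall>\<gamma>\<in>GL_A r. \<forall>\<omega>\<in>Omega \<iota> r. slash r k f (map_mat (emb_A \<iota>) \<gamma>) \<omega> = f \<omega>) \<and>
     (\<exists>c. u_expansion \<iota> r f c \<and> (\<forall>n<0. \<forall>\<omega>\<in>Omega \<iota> (r - 1). c n \<omega> = 0))"


subsection \<open>Hecke operators\<close>

definition S_A :: "nat \<Rightarrow> 'q::{finite, field} poly mat set" where
  "S_A r = {\<alpha> \<in> carrier_mat r r. det \<alpha> \<noteq> 0}"

definition GL_coset :: "nat \<Rightarrow> 'q::{finite, field} poly mat \<Rightarrow> 'q poly mat set" where
  "GL_coset r \<beta> = {\<gamma> * \<beta> | \<gamma>. \<gamma> \<in> GL_A r}"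

definition double_coset :: "nat \<Rightarrow> 'q::{finite, field} poly mat \<Rightarrow> 'q poly mat set" where
  "double_coset r \<alpha> = {\<gamma> * \<alpha> * \<delta> | \<gamma> \<delta>. \<gamma> \<in> GL_A r \<and> \<delta> \<in> GL_A r}"

text \<open>
  The double coset \<open>D\<close> is decomposed into its cosets for left multiplication by \<open>GL_A r\<close>, and a
  representative is chosen in each of them; for modular forms \<open>f\<close> the choice does not matter.
\<close>
definition double_coset_op :: "('q::{finite, field} fls alg_closure \<Rightarrow> 'c::{field, complete_space}) \<Rightarrow> nat \<Rightarrow>
    int \<Rightarrow> 'q poly mat set \<Rightarrow> ('c vec \<Rightarrow> 'c) \<Rightarrow> 'c vec \<Rightarrow> 'c" where
  "double_coset_op \<iota> r k D f \<omega> =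
     (\<Sum>C \<in> GL_coset r ` D. slash r k f (map_mat (emb_A \<iota>) (SOME \<beta>. \<beta> \<in> C)) \<omega>)"

definition hecke_double_cosets :: "nat \<Rightarrow> 'q::{finite, field} poly \<Rightarrow> 'q poly mat set set" where
  "hecke_double_cosets r N =
     double_coset r ` {\<alpha> \<in> S_A r. \<exists>c. c \<noteq> 0 \<and> det \<alpha> = Polynomial.smult c N}"

definition hecke :: "('q::{finite, field} fls alg_closure \<Rightarrow> 'c::{field, complete_space}) \<Rightarrow> nat \<Rightarrow>
    int \<Rightarrow> 'q poly \<Rightarrow> ('c vec \<Rightarrow> 'c) \<Rightarrow> 'c vec \<Rightarrow> 'c" where
  "hecke \<iota> r k N f \<omega> = (\<Sum>D \<in> hecke_double_cosets r N. double_coset_op \<iota> r k D f \<omega>)"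

end

theory Submission
  imports Defs "HOL-Number_Theory.Cong"
begin

text \<open>
  Summing over double cosets, \<open>T\<^sub>N f = \<Sum> f|\<alpha>\<close> over all cosets \<open>\<Gamma>\<alpha>\<close> whose determinant is \<open>N\<close> up to units.
  Hence \<open>T\<^sub>p (T\<^sub>N f)\<close> is the sum of \<open>m(\<alpha>) f|\<alpha>\<close> over the cosets of determinant \<open>p N\<close>, where \<open>m(\<alpha>)\<close> is the
  number of cosets \<open>\<Gamma>\<beta>\<close> of determinant \<open>p\<close> such that \<open>\<beta>\<close> is a right divisor of \<open>\<alpha>\<close>. For irreducible \<open>p\<close>
  these correspond to the lines in the kernel of \<open>\<alpha>\<close> modulo \<open>p\<close>, a nonzero vector space over \<open>A/p\<close>, so
  that \<open>m(\<alpha>) \<equiv> 1\<close> modulo \<open>q\<close>. As \<open>q = 0\<close> in \<open>\<complex>\<^sub>\<infinity>\<close>, it follows that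
  \<open>T\<^sub>p (T\<^sub>N f) = T\<^sub>p\<^sub>N f\<close>, and the general case follows by factorising \<open>M\<close>.
\<close>

unbundle no vec_syntax
no_notation fps_nth (infixl "$" 75)

subsection \<open>Kernels modulo an irreducible polynomial\<close>

text \<open>\<open>S\<close> is the disjoint union of its orbits, and freeness identifies each orbit
  with \<open>'q\<close>. This allows kernels to be counted modulo the field size without dimensions
  over \<open>A/p\<close>.\<close>

lemma free_action_card_dvd:
  fixes act :: "'q::{finite, group_add} \<Rightarrow> 'a \<Rightarrow> 'a"
  assumes "finite S" and closed: "\<And>a x. x \<in> S \<Longrightarrow> act a x \<in> S"
    and zero: "\<And>x. x \<in> S \<Longrightarrow> act 0 x = x"
    and add: "\<And>a b x. x \<in> S \<Longrightarrow> act (a + b) x = act a (act b x)"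
    and free: "\<And>a x. x \<in> S \<Longrightarrow> act a x = x \<Longrightarrow> a = 0"
  shows "CARD('q) dvd card S"
proof -
  have inverse: "act (- a) (act a x) = x" if "x \<in> S" for a x
    using add[OF that, of "- a" a] zero[OF that] by simp
  define orbit where "orbit x = range (\<lambda>a. act a x)" for x
  have orbit_act: "orbit (act a x) = orbit x" if "x \<in> S" for a x
  proof (intro equalityI subsetI)
    fix y assume "y \<in> orbit (act a x)"
    then obtain b where "y = act b (act a x)" by (auto simp: orbit_def)
    then have "y = act (b + a) x" using add[OF that, of b a] by simp
    then show "y \<in> orbit x" by (auto simp: orbit_def)
  next
    fix y assume "y \<in> orbit x"
    then obtain b where "y = act b x" by (auto simp: orbit_def)
    then have "y = act (b + - a) (act a x)"
      using add[OF closed[OF that], of b "- a" a] inverse[OF that] by simp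
    then show "y \<in> orbit (act a x)" by (auto simp: orbit_def)
  qed
  have "card (orbit x) = CARD('q)" if x: "x \<in> S" for x
  proof -
    have "inj (\<lambda>a. act a x)"
    proof (rule injI)
      fix a b assume "act a x = act b x"
      then have "act (- b + a) x = x"
        using add[OF x] inverse[OF x] by simp
      then show "a = b"
        using free[OF x] by (metis add.right_neutral add_minus_cancel)
    qed
    then show ?thesis by (simp add: orbit_def card_image)
  qed
  moreover have "\<Union> (orbit ` S) = S"
  proof (intro equalityI subsetI)
    fix x assume "x \<in> S"
    then have "x \<in> orbit x"
      using zero[of x] unfolding orbit_def by (metis rangeI)
    then show "x \<in> \<Union> (orbit ` S)" using \<open>x \<in> S\<close> by blast
  qed (use closed in \<open>auto simp: orbit_def\<close>)
  moreover have "orbit x = orbit y" if x: "x \<in> S" and y: "y \<in> S" and meet: "orbit x \<inter> orbit y \<noteq> {}" for x y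
  proof -
    obtain a b where "act a x = act b y"
      using meet by (auto simp: orbit_def)
    then show ?thesis
      using orbit_act[OF x, of a] orbit_act[OF y, of b] by simp
  qed
  ultimately show ?thesis
    using dvd_partition[of "orbit ` S" "CARD('q)"] assms(1) by fastforce
qed

text \<open>Vectors over \<open>A/p\<close> are encoded by their reduced representatives, so that
  congruence modulo \<open>p\<close> between them is equality and no quotient type is
  needed.\<close>

definition residue_vecs :: "nat \<Rightarrow> 'q::field poly \<Rightarrow> 'q poly vec set" where
  "residue_vecs r p = {h \<in> carrier_vec r. \<forall>i<r. h $ i mod p = h $ i}"

text \<open>Membership of the class of \<open>h\<close> in the kernel of \<open>\<alpha>\<close>
  over \<open>A/p\<close>.\<close>

definition kills_mod :: "'q::field poly \<Rightarrow> 'q poly mat \<Rightarrow> 'q poly vec \<Rightarrow> bool" where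
  "kills_mod p \<alpha> h \<longleftrightarrow> (\<forall>i<dim_row \<alpha>. p dvd (\<alpha> *\<^sub>v h) $ i)"

lemma finite_residues:
  fixes p :: "'q::{finite, field} poly"
  assumes "p \<noteq> 0"
  shows "finite {a. a mod p = a}"
proof (rule finite_subset)
  show "{a. a mod p = a} \<subseteq> Poly ` {xs. set xs \<subseteq> UNIV \<and> length xs \<le> Suc (degree p)}"
  proof
    fix a assume "a \<in> {a. a mod p = a}"
    \<comment> \<open>The weak inequality also covers the remainder 0 when \<open>p\<close> is
      constant.\<close>
    then have "degree a \<le> degree p"
      using degree_mod_less[OF assms, of a] by auto
    then have "length (coeffs a) \<le> Suc (degree p)"
      by (cases "a = 0") (auto simp: length_coeffs)
    then show "a \<in> Poly ` {xs. set xs \<subseteq> UNIV \<and> length xs \<le> Suc (degree p)}"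
      by (intro image_eqI[of _ _ "coeffs a"]) auto
  qed
  show "finite (Poly ` {xs :: 'q list. set xs \<subseteq> UNIV \<and> length xs \<le> Suc (degree p)})"
    by (intro finite_imageI finite_lists_length_le) auto
qed

lemma finite_residue_vecs:
  fixes p :: "'q::{finite, field} poly"
  assumes "p \<noteq> 0"
  shows "finite (residue_vecs r p)"
proof (rule finite_subset)
  show "residue_vecs r p \<subseteq> vec_of_list ` {xs. set xs \<subseteq> {a. a mod p = a} \<and> length xs = r}"
  proof
    fix h assume h: "h \<in> residue_vecs r p"
    have "set (list_of_vec h) \<subseteq> {a. a mod p = a}"
      using h by (auto simp: residue_vecs_def in_set_conv_nth list_of_vec_index)
    then show "h \<in> vec_of_list ` {xs. set xs \<subseteq> {a. a mod p = a} \<and> length xs = r}"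
      using h by (intro image_eqI[of _ _ "list_of_vec h"]) (auto simp: residue_vecs_def vec_list)
  qed
qed (intro finite_imageI finite_lists_length_eq finite_residues assms)

lemma zero_in_residue_vecs: "0\<^sub>v r \<in> residue_vecs r p"
  by (simp add: residue_vecs_def)

lemma kills_mod_zero: "\<alpha> \<in> carrier_mat r r \<Longrightarrow> kills_mod p \<alpha> (0\<^sub>v r)"
  by (simp add: kills_mod_def)

lemma kills_mod_mult:
  fixes p :: "'q::field poly"
  assumes "\<alpha> \<in> carrier_mat r r" "\<beta> \<in> carrier_mat r r" "h \<in> carrier_vec r" "kills_mod p \<beta> h"
  shows "kills_mod p (\<alpha> * \<beta>) h"
  unfolding kills_mod_def
proof (intro allI impI)
  fix i assume i: "i < dim_row (\<alpha> * \<beta>)"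
  have "((\<alpha> * \<beta>) *\<^sub>v h) $ i = (\<alpha> *\<^sub>v (\<beta> *\<^sub>v h)) $ i"
    using assms by simp
  also have "\<dots> = (\<Sum>l = 0..<r. \<alpha> $$ (i, l) * (\<beta> *\<^sub>v h) $ l)"
    using assms i by (simp add: scalar_prod_def)
  also have "p dvd \<dots>"
    using assms by (intro dvd_sum dvd_mult) (auto simp: kills_mod_def)
  finally show "p dvd ((\<alpha> * \<beta>) *\<^sub>v h) $ i" .
qed

text \<open>The Leibniz formula is polynomial in the entries, so congruences between entries pass to
  the determinant.\<close>

lemma det_cong_one:
  fixes A :: "'q::field poly mat"
  assumes A: "A \<in> carrier_mat r r"
    and cong: "\<And>i j. i < r \<Longrightarrow> j < r \<Longrightarrow> [A $$ (i, j) = 1\<^sub>m r $$ (i, j)] (mod p)"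
  shows "[det A = 1] (mod p)"
proof -
  have "[det A = det (1\<^sub>m r :: 'q poly mat)] (mod p)"
    unfolding det_def'[OF A] det_def'[OF one_carrier_mat]
  proof (intro cong_sum cong_mult cong_refl cong_prod cong)
    fix \<pi> i assume "\<pi> \<in> {\<pi>. \<pi> permutes {0..<r}}" "i \<in> {0..<r}"
    then show "i < r" "\<pi> i < r"
      using permutes_in_image[of \<pi> "{0..<r}" i] by auto
  qed
  then show ?thesis by simp
qed

text \<open>If reduction of \<open>\<alpha>\<close> were injective, it would be surjective and hence invertible modulo \<open>p\<close>.\<close>
lemma ex_kills_mod:
  fixes p :: "'q::{finite, field} poly"
  assumes p: "Factorial_Ring.irreducible p" and \<alpha>: "\<alpha> \<in> carrier_mat r r" and dvd: "p dvd det \<alpha>"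
  shows "\<exists>h\<in>residue_vecs r p. h \<noteq> 0\<^sub>v r \<and> kills_mod p \<alpha> h"
proof (rule ccontr)
  assume trivial: "\<not> ?thesis"
  define \<phi> where "\<phi> h = vec r (\<lambda>i. (\<alpha> *\<^sub>v h) $ i mod p)" for h
  have p0: "p \<noteq> 0" using p by auto
  have "inj_on \<phi> (residue_vecs r p)"
  proof (rule inj_onI)
    fix g h assume gh: "g \<in> residue_vecs r p" "h \<in> residue_vecs r p" "\<phi> g = \<phi> h"
    then have car: "g \<in> carrier_vec r" "h \<in> carrier_vec r"
      by (auto simp: residue_vecs_def)
    \<comment> \<open>Remainders of polynomials, unlike those of integers, are closed under
      subtraction.\<close>
    have "g - h \<in> residue_vecs r p"
      using gh car by (auto simp: residue_vecs_def poly_mod_diff_left)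
    moreover have "kills_mod p \<alpha> (g - h)"
      unfolding kills_mod_def
    proof (intro allI impI)
      fix i assume "i < dim_row \<alpha>"
      then have i: "i < r" using \<alpha> by simp
      have "(\<alpha> *\<^sub>v g) $ i mod p = (\<alpha> *\<^sub>v h) $ i mod p"
        using arg_cong[OF gh(3), of "\<lambda>v. v $ i"] i by (simp add: \<phi>_def)
      moreover have "(\<alpha> *\<^sub>v (g - h)) $ i = (\<alpha> *\<^sub>v g) $ i - (\<alpha> *\<^sub>v h) $ i"
        using \<alpha> car i by (simp add: mult_minus_distrib_mat_vec)
      ultimately show "p dvd (\<alpha> *\<^sub>v (g - h)) $ i"
        by (simp add: mod_eq_dvd_iff)
    qed
    ultimately have "g - h = 0\<^sub>v r" using trivial by auto
    then show "g = h"
      using car by (intro eq_vecI) (auto simp: vec_eq_iff)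
  qed
  moreover have "\<phi> ` residue_vecs r p \<subseteq> residue_vecs r p"
    by (auto simp: residue_vecs_def \<phi>_def)
  ultimately have surj: "\<phi> ` residue_vecs r p = residue_vecs r p"
    using finite_residue_vecs[OF p0] by (intro endo_inj_surj)
  \<comment> \<open>By surjectivity the unit vectors have preimages; for \<open>l < r\<close> these
    become the columns of a right inverse of \<open>\<alpha>\<close> modulo
    \<open>p\<close>.\<close>
  have "\<exists>h\<in>carrier_vec r. \<phi> h = vec r (\<lambda>i. 1\<^sub>m r $$ (i, l) mod p)" for l
  proof -
    have "vec r (\<lambda>i. 1\<^sub>m r $$ (i, l) mod p) \<in> residue_vecs r p"
      by (auto simp: residue_vecs_def)
    then show ?thesis using surj unfolding image_iff
      by (metis (mono_tags, lifting) image_iff mem_Collect_eq residue_vecs_def)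
  qed
  then obtain h where h: "\<And>l. h l \<in> carrier_vec r" "\<And>l. \<phi> (h l) = vec r (\<lambda>i. 1\<^sub>m r $$ (i, l) mod p)"
    by metis
  define \<gamma> where "\<gamma> = mat r r (\<lambda>(i, l). h l $ i)"
  have \<gamma>: "\<gamma> \<in> carrier_mat r r" by (simp add: \<gamma>_def)
  have "[det (\<alpha> * \<gamma>) = 1] (mod p)"
  proof (rule det_cong_one)
    show "\<alpha> * \<gamma> \<in> carrier_mat r r" using \<alpha> \<gamma> by simp
    fix i l assume il: "i < r" "l < r"
    have "col \<gamma> l = h l"
      using h(1)[of l] il by (intro eq_vecI) (auto simp: \<gamma>_def)
    then have "(\<alpha> * \<gamma>) $$ (i, l) = (\<alpha> *\<^sub>v h l) $ i"
      using \<alpha> \<gamma> il by simp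
    then show "[(\<alpha> * \<gamma>) $$ (i, l) = 1\<^sub>m r $$ (i, l)] (mod p)"
      using arg_cong[OF h(2)[of l], of "\<lambda>v. v $ i"] il by (simp add: \<phi>_def cong_def)
  qed
  \<comment> \<open>The determinant of the product is now both 0 and 1 modulo \<open>p\<close>,
    which would make \<open>p\<close> a unit.\<close>
  moreover have "p dvd det (\<alpha> * \<gamma>)"
    using dvd det_mult[OF \<alpha> \<gamma>] by simp
  ultimately have "p dvd 1"
    using cong_dvd_iff by blast
  then show False
    using p by (simp add: Factorial_Ring.irreducible_def)
qed

text \<open>The constants act freely on the kernel: \<open>c\<close> translates by \<open>c\<close>
  times a fixed nonzero kernel vector.\<close>

lemma card_kernel_dvd:
  fixes p :: "'q::{finite, field} poly"
  assumes p: "Factorial_Ring.irreducible p" and \<alpha>: "\<alpha> \<in> carrier_mat r r" and dvd: "p dvd det \<alpha>"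
  shows "CARD('q) dvd card {h \<in> residue_vecs r p. kills_mod p \<alpha> h}"
proof -
  obtain v where v: "v \<in> residue_vecs r p" "v \<noteq> 0\<^sub>v r" "kills_mod p \<alpha> v"
    using ex_kills_mod[OF assms] by auto
  have vc: "v \<in> carrier_vec r" using v by (simp add: residue_vecs_def)
  obtain i where i: "i < r" "v $ i \<noteq> 0"
    using v(2) vc by (metis carrier_vecD eq_vecI index_zero_vec)
  have p0: "p \<noteq> 0" using p by auto
  \<comment> \<open>Constant multiples and sums of reduced vectors are reduced, so no reduction
    modulo \<open>p\<close> has to follow the translation.\<close>
  let ?act = "\<lambda>c h. h + [:c:] \<cdot>\<^sub>v v"
  show ?thesis
  proof (rule free_action_card_dvd[where act = ?act])
    show "finite {h \<in> residue_vecs r p. kills_mod p \<alpha> h}"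
      using finite_residue_vecs[OF p0] by simp
    fix a b h assume "h \<in> {h \<in> residue_vecs r p. kills_mod p \<alpha> h}"
    then have h: "h \<in> residue_vecs r p" "kills_mod p \<alpha> h" "h \<in> carrier_vec r"
      by (auto simp: residue_vecs_def)
    have "?act a h \<in> residue_vecs r p"
      using h v(1) by (auto simp: residue_vecs_def poly_mod_add_left mod_smult_left)
    moreover have "kills_mod p \<alpha> (?act a h)"
      unfolding kills_mod_def
    proof (intro allI impI)
      fix j assume j: "j < dim_row \<alpha>"
      have "\<alpha> *\<^sub>v ([:a:] \<cdot>\<^sub>v v) = [:a:] \<cdot>\<^sub>v (\<alpha> *\<^sub>v v)"
        using \<alpha> vc by (intro eq_vecI) auto
      then have "(\<alpha> *\<^sub>v (?act a h)) $ j = (\<alpha> *\<^sub>v h) $ j + [:a:] * (\<alpha> *\<^sub>v v) $ j"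
        using \<alpha> h vc j by (simp add: mult_add_distrib_mat_vec[OF \<alpha>])
      then show "p dvd (\<alpha> *\<^sub>v (?act a h)) $ j"
        using h(2) v(3) j by (metis dvd_add dvd_mult kills_mod_def)
    qed
    ultimately show "?act a h \<in> {h \<in> residue_vecs r p. kills_mod p \<alpha> h}" by simp
    show "?act 0 h = h"
      using h vc by (intro eq_vecI) auto
    show "?act (a + b) h = ?act a (?act b h)"
      using h vc by (intro eq_vecI) (auto simp: smult_add_left)
    \<comment> \<open>Freeness is read off at the coordinate \<open>i\<close>, where
      \<open>v\<close> is nonzero.\<close>
    assume fixed: "?act a h = h"
    have "?act a h $ i = h $ i + smult a (v $ i)" using i vc by simp
    then have "h $ i + smult a (v $ i) = h $ i" unfolding fixed by simp
    then show "a = 0" using i by simp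
  qed
qed

text \<open>As \<open>p\<close> is prime, multiplication by \<open>a\<close> is injective on the
  finite set of remainders, hence surjective, and attains \<open>1 mod p\<close>.\<close>

lemma inverse_mod_irreducible:
  fixes p :: "'q::{finite, field} poly"
  assumes p: "Factorial_Ring.irreducible p" and a: "\<not> p dvd a"
  shows "\<exists>u. [u * a = 1] (mod p)"
proof -
  let ?R = "{x. x mod p = x}"
  have p0: "p \<noteq> 0" using p by auto
  have "inj_on (\<lambda>x. x * a mod p) ?R"
  proof (rule inj_onI)
    fix x y assume xy: "x \<in> ?R" "y \<in> ?R" "x * a mod p = y * a mod p"
    then have "p dvd (x - y) * a"
      by (simp add: mod_eq_dvd_iff algebra_simps)
    then have "p dvd x - y"
      using field_poly_irreducible_imp_prime[OF p] a by (simp add: prime_elem_dvd_mult_iff)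
    then have "x mod p = y mod p" by (simp add: mod_eq_dvd_iff)
    then show "x = y" using xy by simp
  qed
  then have "(\<lambda>x. x * a mod p) ` ?R = ?R"
    using finite_residues[OF p0] by (intro endo_inj_surj) auto
  then have "1 mod p \<in> (\<lambda>x. x * a mod p) ` ?R" by simp
  then obtain u where "u * a mod p = 1 mod p" by (elim imageE) simp
  then show ?thesis by (auto simp: cong_def)
qed

section \<open>Matrices with prescribed determinant up to units\<close>

definition det_class :: "nat \<Rightarrow> 'q::{finite, field} poly \<Rightarrow> 'q poly mat set" where
  "det_class r N = {\<alpha> \<in> carrier_mat r r. \<exists>c. c \<noteq> 0 \<and> det \<alpha> = smult c N}"

lemma det_class_carrier: "\<alpha> \<in> det_class r N \<Longrightarrow> \<alpha> \<in> carrier_mat r r"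
  by (simp add: det_class_def)

lemma det_class_det_nz: "\<alpha> \<in> det_class r N \<Longrightarrow> N \<noteq> 0 \<Longrightarrow> det \<alpha> \<noteq> 0"
  by (auto simp: det_class_def)

lemma det_class_smult:
  assumes "c \<noteq> 0"
  shows "det_class r (smult c N) = det_class r N"
proof (intro equalityI subsetI)
  fix \<alpha> assume "\<alpha> \<in> det_class r (smult c N)"
  then obtain d where "\<alpha> \<in> carrier_mat r r" "d \<noteq> 0" "det \<alpha> = smult d (smult c N)"
    by (auto simp: det_class_def)
  then show "\<alpha> \<in> det_class r N"
    using assms by (auto simp: det_class_def intro!: exI[of _ "d * c"])
next
  fix \<alpha> assume "\<alpha> \<in> det_class r N"
  then obtain d where "\<alpha> \<in> carrier_mat r r" "d \<noteq> 0" "det \<alpha> = smult d N"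
    by (auto simp: det_class_def)
  then show "\<alpha> \<in> det_class r (smult c N)"
    using assms by (auto simp: det_class_def intro!: exI[of _ "d / c"])
qed

lemma det_class_mult:
  assumes "\<alpha> \<in> det_class r M" "\<beta> \<in> det_class r N"
  shows "\<alpha> * \<beta> \<in> det_class r (M * N)"
proof -
  obtain c d where cd: "c \<noteq> 0" "det \<alpha> = smult c M" "d \<noteq> 0" "det \<beta> = smult d N"
    using assms by (auto simp: det_class_def)
  have carrier: "\<alpha> \<in> carrier_mat r r" "\<beta> \<in> carrier_mat r r"
    using assms by (auto dest: det_class_carrier)
  then have "det (\<alpha> * \<beta>) = smult (c * d) (M * N)"
    using cd by (simp add: det_mult mult.commute)
  then show ?thesis
    using carrier cd(1,3) by (auto simp: det_class_def intro!: exI[of _ "c * d"])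
qed

text \<open>Determinants are multiplicative and \<open>M\<close> cancels in the domain
  \<open>A\<close>.\<close>

lemma det_class_cancel:
  assumes "\<alpha> * \<beta> \<in> det_class r (N * M)" "\<beta> \<in> det_class r M" "\<alpha> \<in> carrier_mat r r" "M \<noteq> 0"
  shows "\<alpha> \<in> det_class r N"
proof -
  obtain c d where cd: "c \<noteq> 0" "det (\<alpha> * \<beta>) = smult c (N * M)" "d \<noteq> 0" "det \<beta> = smult d M"
    using assms by (auto simp: det_class_def)
  then have "det \<alpha> * smult d M = smult c (N * M)"
    using assms by (simp add: det_mult[OF assms(3) det_class_carrier])
  then have "smult d (det \<alpha>) * M = smult c N * M" by (simp add: mult.commute)
  then have "smult d (det \<alpha>) = smult c N" using assms(4) mult_right_cancel by blast
  then have "det \<alpha> = smult (c / d) N"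
    using cd by (metis (no_types) divide_self_if smult_1_left smult_smult divide_inverse mult.commute left_inverse)
  then show ?thesis
    using assms(3) cd by (auto simp: det_class_def intro!: exI[of _ "c / d"])
qed

text \<open>Multiplication by the adjugate turns \<open>\<beta>\<close> into the scalar
  \<open>det \<beta>\<close>, which cancels entrywise in a domain.\<close>

lemma mult_right_cancel_mat:
  fixes \<beta> :: "'a::idom mat"
  assumes "\<alpha> \<in> carrier_mat r r" "\<alpha>' \<in> carrier_mat r r" "\<beta> \<in> carrier_mat r r" "det \<beta> \<noteq> 0"
    and eq: "\<alpha> * \<beta> = \<alpha>' * \<beta>"
  shows "\<alpha> = \<alpha>'"
proof -
  have *: "\<gamma> * \<beta> * adj_mat \<beta> = det \<beta> \<cdot>\<^sub>m \<gamma>" if "\<gamma> \<in> carrier_mat r r" for \<gamma>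
    using that adj_mat[OF assms(3)] assms(3)
    by (simp add: assoc_mult_mat[of _ r r _ r _ r] mult_smult_distrib[of _ r r _ r])
  have "det \<beta> \<cdot>\<^sub>m \<alpha> = det \<beta> \<cdot>\<^sub>m \<alpha>'"
    using *[OF assms(1)] *[OF assms(2)] eq by simp
  then show ?thesis
    using assms by (intro eq_matI) (auto simp: mat_eq_iff)
qed

text \<open>A matrix over \<open>A\<close> is invertible iff its determinant is a unit, that is, a
  nonzero constant. In this form the product and cancellation rules for \<open>det_class\<close>
  apply to \<open>GL_A\<close>.\<close>

lemma GL_A_eq: "(GL_A r :: 'q::{finite, field} poly mat set) = det_class r 1"
proof (intro equalityI subsetI)
  fix \<gamma> :: "'q poly mat" assume "\<gamma> \<in> GL_A r"
  then obtain \<delta> where \<gamma>: "\<gamma> \<in> carrier_mat r r" and *: "\<gamma> * \<delta> = 1\<^sub>m (dim_row \<gamma>)" "\<delta> * \<gamma> = 1\<^sub>m (dim_row \<delta>)"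
    by (auto simp: GL_A_def invertible_mat_def inverts_mat_def)
  have "\<delta> \<in> carrier_mat r r"
    using \<gamma> * by (metis carrier_matD carrier_matI index_mult_mat(2,3) index_one_mat(2,3))
  then have "det \<gamma> * det \<delta> = 1"
    using \<gamma> * by (metis carrier_matD(1) det_mult det_one)
  then have "det \<gamma> dvd 1" by (metis dvd_triv_left)
  then obtain c where c: "det \<gamma> = [:c:]" "c dvd 1"
    by (auto simp: is_unit_poly_iff)
  then have "c \<noteq> 0" by auto
  then show "\<gamma> \<in> det_class r 1"
    using \<gamma> c(1) by (auto simp: det_class_def intro!: exI[of _ c])
next
  fix \<gamma> :: "'q poly mat" assume "\<gamma> \<in> det_class r 1"
  then obtain c where \<gamma>: "\<gamma> \<in> carrier_mat r r" and c: "c \<noteq> 0" "det \<gamma> = [:c:]"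
    by (auto simp: det_class_def)
  \<comment> \<open>The inverse is the adjugate divided by the constant determinant.\<close>
  let ?\<delta> = "[:inverse c:] \<cdot>\<^sub>m adj_mat \<gamma>"
  have unit: "[:inverse c:] \<cdot>\<^sub>m ([:c:] \<cdot>\<^sub>m 1\<^sub>m r) = 1\<^sub>m r"
    using c(1) by (intro eq_matI) (auto simp: one_pCons)
  have "\<gamma> * ?\<delta> = 1\<^sub>m r"
    using unit c(2) adj_mat[OF \<gamma>] mult_smult_distrib[OF \<gamma> adj_mat(1)[OF \<gamma>], of "[:inverse c:]"] by simp
  moreover have "?\<delta> * \<gamma> = 1\<^sub>m r"
    using unit c(2) adj_mat[OF \<gamma>] mult_smult_assoc_mat[OF adj_mat(1)[OF \<gamma>] \<gamma>, of "[:inverse c:]"] by simp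
  ultimately show "\<gamma> \<in> GL_A r"
    using \<gamma> adj_mat(1)[OF \<gamma>]
    by (auto simp: GL_A_def invertible_mat_def inverts_mat_def square_mat.simps intro!: exI[of _ ?\<delta>])
qed

text \<open>
  The rows of the matrix constructed here are a basis of the lattice of all row vectors \<open>x\<close> with
  \<open>x \<cdot> h\<close> divisible by \<open>p\<close>.
\<close>
lemma ex_divisor_killing:
  fixes p :: "'q::{finite, field} poly"
  assumes p: "Factorial_Ring.irreducible p" and h: "h \<in> residue_vecs r p" "h \<noteq> 0\<^sub>v r"
  shows "\<exists>\<beta>\<in>det_class r p. kills_mod p \<beta> h \<and>
    (\<forall>\<alpha>\<in>carrier_mat r r. kills_mod p \<alpha> h \<longrightarrow> (\<exists>\<alpha>'\<in>carrier_mat r r. \<alpha> = \<alpha>' * \<beta>))"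
proof -
  have hc: "h \<in> carrier_vec r" using h by (simp add: residue_vecs_def)
  obtain i where i: "i < r" "h $ i \<noteq> 0"
    using h(2) hc by (metis carrier_vecD eq_vecI index_zero_vec)
  then have "\<not> p dvd h $ i"
    using h(1) by (auto simp: residue_vecs_def dvd_eq_mod_eq_0)
  then obtain u where u: "[u * h $ i = 1] (mod p)"
    using inverse_mod_irreducible[OF p] by blast
  \<comment> \<open>This is the identity matrix with column \<open>i\<close> replaced:
    \<open>p\<close> on the diagonal, and in the other rows \<open>j\<close> the entry
    \<open>- (h $ j * u)\<close>, which cancels \<open>h $ j\<close> modulo \<open>p\<close> because
    \<open>u\<close> inverts \<open>h $ i\<close>.\<close>
  define \<beta> where "\<beta> = mat r r (\<lambda>(j, l). if j = i then (if l = i then p else 0)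
     else if l = j then 1 else if l = i then - (h $ j * u) else 0)"
  have \<beta>: "\<beta> \<in> carrier_mat r r" by (simp add: \<beta>_def)
  have "mat_delete \<beta> i i = 1\<^sub>m (r - 1)"
    using i by (intro eq_matI) (auto simp: mat_delete_def \<beta>_def)
  then have "cofactor \<beta> i i = 1" by (simp add: cofactor_def)
  \<comment> \<open>In row \<open>i\<close> only the diagonal entry \<open>p\<close> is
    nonzero.\<close>
  have "det \<beta> = (\<Sum>l<r. \<beta> $$ (i, l) * cofactor \<beta> i l)"
    by (rule laplace_expansion_row[OF \<beta> i(1)])
  also have "\<dots> = (\<Sum>l<r. if l = i then p else 0)"
    using i \<open>cofactor \<beta> i i = 1\<close> by (intro sum.cong) (auto simp: \<beta>_def)
  also have "\<dots> = p" using i by simp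
  finally have "\<beta> \<in> det_class r p"
    using \<beta> by (auto simp: det_class_def intro!: exI[of _ 1])
  moreover have "kills_mod p \<beta> h"
    unfolding kills_mod_def
  proof (intro allI impI)
    fix j assume "j < dim_row \<beta>"
    then have j: "j < r" by (simp add: \<beta>_def)
    have eq: "(\<beta> *\<^sub>v h) $ j = (\<Sum>l = 0..<r. \<beta> $$ (j, l) * h $ l)"
      using j \<beta> hc by (simp add: scalar_prod_def)
    show "p dvd (\<beta> *\<^sub>v h) $ j"
    proof (cases "j = i")
      case True
      have "p dvd \<beta> $$ (j, l) * h $ l" if "l < r" for l
        using that j True by (simp add: \<beta>_def)
      then show ?thesis unfolding eq by (intro dvd_sum) simp
    next
      case False
      have "(\<beta> *\<^sub>v h) $ j = (\<Sum>l = 0..<r. (if l = j then h $ j else 0) + (if l = i then - (h $ j * u) * h $ i else 0))"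
        unfolding eq using False j by (intro sum.cong) (auto simp: \<beta>_def)
      also have "\<dots> = h $ j * (1 - u * h $ i)"
        using i j by (simp add: sum.distrib algebra_simps)
      finally show ?thesis
        using u by (metis cong_iff_dvd_diff cong_sym dvd_mult)
    qed
  qed
  moreover have "\<exists>\<alpha>'\<in>carrier_mat r r. \<alpha> = \<alpha>' * \<beta>"
    if \<alpha>: "\<alpha> \<in> carrier_mat r r" and kills: "kills_mod p \<alpha> h" for \<alpha>
  proof -
    \<comment> \<open>Comparing column \<open>i\<close> in
      \<open>\<alpha> = \<alpha>' * \<beta>\<close> forces \<open>p\<close> times the entry
      \<open>(j, i)\<close> of \<open>\<alpha>'\<close> to be \<open>x j\<close>. The other columns
      of \<open>\<alpha>'\<close> agree with those of \<open>\<alpha>\<close>.\<close>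
    define x where "x j = \<alpha> $$ (j, i) + (\<Sum>l\<in>{0..<r} - {i}. \<alpha> $$ (j, l) * (h $ l * u))" for j
    have "p dvd x j" if j: "j < r" for j
    proof -
      have "(\<alpha> *\<^sub>v h) $ j = (\<Sum>l = 0..<r. \<alpha> $$ (j, l) * h $ l)"
        using j \<alpha> hc by (simp add: scalar_prod_def)
      also have "\<dots> = \<alpha> $$ (j, i) * h $ i + (\<Sum>l\<in>{0..<r} - {i}. \<alpha> $$ (j, l) * h $ l)"
        using i by (intro sum.remove) auto
      finally have "(\<alpha> *\<^sub>v h) $ j * u = \<alpha> $$ (j, i) * (u * h $ i) + (\<Sum>l\<in>{0..<r} - {i}. \<alpha> $$ (j, l) * (h $ l * u))"
        by (simp add: algebra_simps sum_distrib_left)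
      \<comment> \<open>Modulo \<open>p\<close>, \<open>x j\<close> is \<open>u\<close> times the
        entry \<open>j\<close> of \<open>\<alpha> *\<^sub>v h\<close>, since
        \<open>u * h $ i\<close> is 1.\<close>
      then have "x j = (\<alpha> *\<^sub>v h) $ j * u - \<alpha> $$ (j, i) * (u * h $ i - 1)"
        by (simp add: x_def algebra_simps)
      moreover have "p dvd (\<alpha> *\<^sub>v h) $ j * u" "p dvd u * h $ i - 1"
        using kills j \<alpha> u by (auto simp: kills_mod_def cong_iff_dvd_diff)
      ultimately show ?thesis
        by (metis dvd_diff dvd_mult)
    qed
    then have y: "(x j div p) * p = x j" if "j < r" for j
      using that by simp
    define \<alpha>' where "\<alpha>' = mat r r (\<lambda>(j, l). if l = i then x j div p else \<alpha> $$ (j, l))"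
    have "\<alpha> = \<alpha>' * \<beta>"
    proof (rule eq_matI)
      fix j m assume "j < dim_row (\<alpha>' * \<beta>)" "m < dim_col (\<alpha>' * \<beta>)"
      then have jm: "j < r" "m < r" by (auto simp: \<alpha>'_def \<beta>_def)
      have "(\<alpha>' * \<beta>) $$ (j, m) = (\<Sum>l = 0..<r. \<alpha>' $$ (j, l) * \<beta> $$ (l, m))"
        using jm by (simp add: \<alpha>'_def \<beta>_def scalar_prod_def)
      also have "\<dots> = \<alpha>' $$ (j, i) * \<beta> $$ (i, m) + (\<Sum>l\<in>{0..<r} - {i}. \<alpha>' $$ (j, l) * \<beta> $$ (l, m))"
        using i by (intro sum.remove) auto
      also have "\<dots> = \<alpha> $$ (j, m)"
      proof (cases "m = i")
        case True
        have "(\<Sum>l\<in>{0..<r} - {i}. \<alpha>' $$ (j, l) * \<beta> $$ (l, m)) = - (\<Sum>l\<in>{0..<r} - {i}. \<alpha> $$ (j, l) * (h $ l * u))"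
          unfolding sum_negf[symmetric] using True jm i by (intro sum.cong) (auto simp: \<alpha>'_def \<beta>_def)
        moreover have "\<alpha>' $$ (j, i) * \<beta> $$ (i, m) = x j div p * p"
          using True jm i by (simp add: \<alpha>'_def \<beta>_def)
        ultimately show ?thesis
          using y[OF jm(1)] True by (simp add: x_def)
      next
        case False
        have "(\<Sum>l\<in>{0..<r} - {i}. \<alpha>' $$ (j, l) * \<beta> $$ (l, m)) = (\<Sum>l\<in>{0..<r} - {i}. if l = m then \<alpha> $$ (j, m) else 0)"
          using False jm i by (intro sum.cong) (auto simp: \<alpha>'_def \<beta>_def)
        also have "\<dots> = \<alpha> $$ (j, m)" using False jm by simp
        finally show ?thesis using False jm i by (simp add: \<beta>_def)
      qed
      finally show "\<alpha> $$ (j, m) = (\<alpha>' * \<beta>) $$ (j, m)" by simp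
    qed (use \<alpha> in \<open>auto simp: \<alpha>'_def \<beta>_def\<close>)
    then show ?thesis by (auto simp: \<alpha>'_def)
  qed
  ultimately show ?thesis by blast
qed


subsection \<open>Cosets of matrices over \<open>A\<close>\<close>

lemma GL_A_carrier: "\<gamma> \<in> GL_A r \<Longrightarrow> \<gamma> \<in> carrier_mat r r"
  by (simp add: GL_A_def)

lemma GL_A_mult: "\<gamma> \<in> GL_A r \<Longrightarrow> \<delta> \<in> GL_A r \<Longrightarrow> \<gamma> * \<delta> \<in> GL_A r"
  unfolding GL_A_eq using det_class_mult[of \<gamma> r 1 \<delta> 1] by simp

lemma GL_A_one: "1\<^sub>m r \<in> GL_A r"
  unfolding GL_A_eq by (auto simp: det_class_def intro!: exI[of _ 1])

lemma GL_A_inverse: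
  assumes \<gamma>: "\<gamma> \<in> GL_A r"
  obtains \<delta> where "\<delta> \<in> GL_A r" "\<delta> * \<gamma> = 1\<^sub>m r" "\<gamma> * \<delta> = 1\<^sub>m r"
proof -
  obtain \<delta> where car: "\<gamma> \<in> carrier_mat r r" and *: "\<gamma> * \<delta> = 1\<^sub>m (dim_row \<gamma>)" "\<delta> * \<gamma> = 1\<^sub>m (dim_row \<delta>)"
    using \<gamma> by (auto simp: GL_A_def invertible_mat_def inverts_mat_def)
  have \<delta>: "\<delta> \<in> carrier_mat r r"
    using car arg_cong[OF *(1), of dim_col] arg_cong[OF *(2), of dim_col] by auto
  then have "\<delta> \<in> GL_A r"
    using car * by (auto simp: GL_A_def invertible_mat_def inverts_mat_def square_mat.simps)
  then show thesis using that * car \<delta> by auto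
qed

lemma mat_mult_assoc4:
  assumes "A \<in> carrier_mat r r" "B \<in> carrier_mat r r" "C \<in> carrier_mat r r" "D \<in> carrier_mat r r"
  shows "(A * B) * (C * D) = A * ((B * C) * D)"
  using assms by (simp add: assoc_mult_mat[of _ r r _ r _ r])

lemma GL_coset_self: "\<alpha> \<in> carrier_mat r r \<Longrightarrow> \<alpha> \<in> GL_coset r \<alpha>"
  using GL_A_one[of r] by (auto simp: GL_coset_def intro!: exI[of _ "1\<^sub>m r"])

lemma GL_coset_mult:
  assumes \<gamma>: "\<gamma> \<in> GL_A r" and \<alpha>: "\<alpha> \<in> carrier_mat r r"
  shows "GL_coset r (\<gamma> * \<alpha>) = GL_coset r \<alpha>"
proof (intro equalityI subsetI)
  fix \<beta> assume "\<beta> \<in> GL_coset r (\<gamma> * \<alpha>)"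
  then obtain \<delta> where \<delta>: "\<delta> \<in> GL_A r" "\<beta> = \<delta> * (\<gamma> * \<alpha>)"
    by (auto simp: GL_coset_def)
  then have "\<beta> = (\<delta> * \<gamma>) * \<alpha>"
    using assms by (simp add: assoc_mult_mat[of _ r r _ r _ r] GL_A_carrier)
  then show "\<beta> \<in> GL_coset r \<alpha>"
    using GL_A_mult[OF \<delta>(1) \<gamma>] by (auto simp: GL_coset_def)
next
  fix \<beta> assume "\<beta> \<in> GL_coset r \<alpha>"
  then obtain \<delta> where \<delta>: "\<delta> \<in> GL_A r" "\<beta> = \<delta> * \<alpha>"
    by (auto simp: GL_coset_def)
  obtain \<gamma>' where \<gamma>': "\<gamma>' \<in> GL_A r" "\<gamma>' * \<gamma> = 1\<^sub>m r"
    using GL_A_inverse[OF \<gamma>] by metis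
  have "(\<delta> * \<gamma>') * (\<gamma> * \<alpha>) = \<delta> * ((\<gamma>' * \<gamma>) * \<alpha>)"
    using assms \<delta>(1) \<gamma>'(1) by (intro mat_mult_assoc4) (auto dest: GL_A_carrier)
  then have "\<beta> = (\<delta> * \<gamma>') * (\<gamma> * \<alpha>)"
    using \<gamma>'(2) \<delta> \<alpha> by simp
  then show "\<beta> \<in> GL_coset r (\<gamma> * \<alpha>)"
    using GL_A_mult[OF \<delta>(1) \<gamma>'(1)] by (auto simp: GL_coset_def)
qed

text \<open>The index set of the Hecke sum once the double cosets have been merged.\<close>

definition cosets :: "nat \<Rightarrow> 'q::{finite, field} poly \<Rightarrow> 'q poly mat set set" where
  "cosets r N = GL_coset r ` det_class r N"

text \<open>The same choice of representative as in \<open>double_coset_op\<close>.\<close>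

definition rep :: "'q::{finite, field} poly mat set \<Rightarrow> 'q poly mat" where
  "rep C = (SOME \<beta>. \<beta> \<in> C)"

definition right_dvd :: "nat \<Rightarrow> 'q::{finite, field} poly mat \<Rightarrow> 'q poly mat \<Rightarrow> bool" where
  "right_dvd r \<beta> \<alpha> \<longleftrightarrow> (\<exists>\<alpha>'\<in>carrier_mat r r. \<alpha> = \<alpha>' * \<beta>)"

lemma rep_GL_coset:
  assumes "\<alpha> \<in> carrier_mat r r"
  obtains \<gamma> where "\<gamma> \<in> GL_A r" "rep (GL_coset r \<alpha>) = \<gamma> * \<alpha>"
proof -
  have "rep (GL_coset r \<alpha>) \<in> GL_coset r \<alpha>"
    unfolding rep_def using GL_coset_self[OF assms] by (rule someI)
  then show thesis using that by (auto simp: GL_coset_def)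
qed

lemma rep_cosets:
  assumes "C \<in> cosets r N"
  shows rep_det_class: "rep C \<in> det_class r N" and GL_coset_rep: "GL_coset r (rep C) = C"
proof -
  obtain \<alpha> where \<alpha>: "\<alpha> \<in> det_class r N" "C = GL_coset r \<alpha>"
    using assms by (auto simp: cosets_def)
  obtain \<gamma> where \<gamma>: "\<gamma> \<in> GL_A r" "rep C = \<gamma> * \<alpha>"
    using rep_GL_coset[OF det_class_carrier[OF \<alpha>(1)]] \<alpha>(2) by metis
  show "rep C \<in> det_class r N"
    using \<gamma> det_class_mult[of \<gamma> r 1 \<alpha> N] \<alpha>(1) by (simp add: GL_A_eq)
  show "GL_coset r (rep C) = C"
    using GL_coset_mult[OF \<gamma>(1) det_class_carrier[OF \<alpha>(1)]] \<gamma>(2) \<alpha>(2) by simp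
qed

lemma rep_carrier: "C \<in> cosets r N \<Longrightarrow> rep C \<in> carrier_mat r r"
  using rep_det_class det_class_carrier by blast

lemma GL_coset_eq_imp:
  assumes "\<alpha> \<in> carrier_mat r r" "GL_coset r \<alpha> = GL_coset r \<beta>"
  obtains \<gamma> where "\<gamma> \<in> GL_A r" "\<alpha> = \<gamma> * \<beta>"
  using GL_coset_self[OF assms(1)] assms(2) that by (auto simp: GL_coset_def)

text \<open>Injectivity holds because \<open>\<beta>\<close> can be cancelled on the right,
  surjectivity because the left factor of a matrix in class \<open>N * M\<close> that is divisible
  by \<open>\<beta>\<close> lies in class \<open>N\<close>. The bijection reindexes the Hecke sum
  after slashing by \<open>\<beta>\<close>.\<close>

lemma bij_betw_cosets_mult:
  assumes \<beta>: "\<beta> \<in> det_class r M" and M: "M \<noteq> 0"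
  shows "bij_betw (\<lambda>C. GL_coset r (rep C * \<beta>)) (cosets r N)
    {E \<in> cosets r (N * M). right_dvd r \<beta> (rep E)}"
  unfolding bij_betw_def
proof (intro conjI equalityI subsetI)
  note \<beta>c = det_class_carrier[OF \<beta>]
  have assoc: "\<gamma> * (\<alpha> * \<beta>) = (\<gamma> * \<alpha>) * \<beta>" if "\<gamma> \<in> carrier_mat r r" "\<alpha> \<in> carrier_mat r r" for \<gamma> \<alpha>
    using that \<beta>c by (simp add: assoc_mult_mat[of _ r r _ r _ r])
  show "inj_on (\<lambda>C. GL_coset r (rep C * \<beta>)) (cosets r N)"
  proof (rule inj_onI)
    fix C D assume CD: "C \<in> cosets r N" "D \<in> cosets r N" "GL_coset r (rep C * \<beta>) = GL_coset r (rep D * \<beta>)"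
    note carrier = rep_carrier[OF CD(1)] rep_carrier[OF CD(2)]
    obtain \<gamma> where \<gamma>: "\<gamma> \<in> GL_A r" "rep C * \<beta> = \<gamma> * (rep D * \<beta>)"
      by (rule GL_coset_eq_imp[OF mult_carrier_mat[OF carrier(1) \<beta>c] CD(3)])
    note \<gamma>c = GL_A_carrier[OF \<gamma>(1)]
    have "rep C = \<gamma> * rep D"
      by (rule mult_right_cancel_mat[OF carrier(1) mult_carrier_mat[OF \<gamma>c carrier(2)] \<beta>c
            det_class_det_nz[OF \<beta> M] trans[OF \<gamma>(2) assoc[OF \<gamma>c carrier(2)]]])
    then have "GL_coset r (rep C) = GL_coset r (\<gamma> * rep D)" by (rule arg_cong)
    also have "\<dots> = GL_coset r (rep D)" by (rule GL_coset_mult[OF \<gamma>(1) carrier(2)])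
    finally show "C = D"
      unfolding GL_coset_rep[OF CD(1)] GL_coset_rep[OF CD(2)] .
  qed
  fix E
  {
    assume "E \<in> (\<lambda>C. GL_coset r (rep C * \<beta>)) ` cosets r N"
    then obtain C where C: "C \<in> cosets r N" "E = GL_coset r (rep C * \<beta>)" by auto
    note carrier = rep_carrier[OF C(1)]
    have "E \<in> cosets r (N * M)"
      unfolding C(2) cosets_def using det_class_mult[OF rep_det_class[OF C(1)] \<beta>] by (rule imageI)
    moreover obtain \<gamma> where \<gamma>: "\<gamma> \<in> GL_A r" "rep (GL_coset r (rep C * \<beta>)) = \<gamma> * (rep C * \<beta>)"
      by (rule rep_GL_coset[OF mult_carrier_mat[OF carrier \<beta>c]])
    have "rep E = (\<gamma> * rep C) * \<beta>"
      unfolding C(2) \<gamma>(2) by (rule assoc[OF GL_A_carrier[OF \<gamma>(1)] carrier])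
    then have "right_dvd r \<beta> (rep E)"
      unfolding right_dvd_def using mult_carrier_mat[OF GL_A_carrier[OF \<gamma>(1)] carrier] by blast
    ultimately show "E \<in> {E \<in> cosets r (N * M). right_dvd r \<beta> (rep E)}" by simp
  next
    assume "E \<in> {E \<in> cosets r (N * M). right_dvd r \<beta> (rep E)}"
    then obtain \<alpha> where E: "E \<in> cosets r (N * M)" and \<alpha>: "\<alpha> \<in> carrier_mat r r" "rep E = \<alpha> * \<beta>"
      by (auto simp: right_dvd_def)
    then have "\<alpha> \<in> det_class r N"
      using det_class_cancel[OF _ \<beta> \<alpha>(1) M] rep_det_class[OF E] by simp
    then have C: "GL_coset r \<alpha> \<in> cosets r N" by (simp add: cosets_def)
    obtain \<gamma> where \<gamma>: "\<gamma> \<in> GL_A r" "rep (GL_coset r \<alpha>) = \<gamma> * \<alpha>"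
      by (rule rep_GL_coset[OF \<alpha>(1)])
    have "GL_coset r (rep (GL_coset r \<alpha>) * \<beta>) = GL_coset r (\<gamma> * (\<alpha> * \<beta>))"
      unfolding \<gamma>(2) assoc[OF GL_A_carrier[OF \<gamma>(1)] \<alpha>(1)] ..
    also have "\<dots> = GL_coset r (rep E)"
      unfolding \<alpha>(2) by (rule GL_coset_mult[OF \<gamma>(1) mult_carrier_mat[OF \<alpha>(1) \<beta>c]])
    also have "\<dots> = E" by (rule GL_coset_rep[OF E])
    finally show "E \<in> (\<lambda>C. GL_coset r (rep C * \<beta>)) ` cosets r N"
      using C by (intro image_eqI[of _ _ "GL_coset r \<alpha>"]) auto
  }
qed

section \<open>Right divisors of irreducible determinant\<close>

lemma kills_mod_right_dvd:
  assumes "right_dvd r \<beta> \<alpha>" "\<beta> \<in> carrier_mat r r" "h \<in> carrier_vec r" "kills_mod p \<beta> h"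
  shows "kills_mod p \<alpha> h"
  using assms kills_mod_mult by (auto simp: right_dvd_def)

text \<open>The coset is that of the matrix from \<open>ex_divisor_killing\<close>. It is unique
  because any other candidate is a left multiple of that matrix with the same determinant up to
  units.\<close>

lemma coset_killing:
  fixes p :: "'q::{finite, field} poly"
  assumes p: "Factorial_Ring.irreducible p" and h: "h \<in> residue_vecs r p" "h \<noteq> 0\<^sub>v r"
  shows "\<exists>C\<in>cosets r p. kills_mod p (rep C) h \<and>
    (\<forall>\<alpha>\<in>carrier_mat r r. kills_mod p \<alpha> h \<longrightarrow> right_dvd r (rep C) \<alpha>) \<and>
    (\<forall>D\<in>cosets r p. kills_mod p (rep D) h \<longrightarrow> D = C)"
proof -
  have hc: "h \<in> carrier_vec r" using h by (simp add: residue_vecs_def)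
  have p0: "p \<noteq> 0" using p by auto
  obtain \<beta> where \<beta>: "\<beta> \<in> det_class r p" "kills_mod p \<beta> h"
    and dvd: "\<And>\<alpha>. \<alpha> \<in> carrier_mat r r \<Longrightarrow> kills_mod p \<alpha> h \<Longrightarrow> right_dvd r \<beta> \<alpha>"
    using ex_divisor_killing[OF p h] unfolding right_dvd_def by metis
  note \<beta>c = det_class_carrier[OF \<beta>(1)]
  obtain \<gamma> where \<gamma>: "\<gamma> \<in> GL_A r" "rep (GL_coset r \<beta>) = \<gamma> * \<beta>"
    using rep_GL_coset[OF \<beta>c] by metis
  obtain \<delta> where \<delta>: "\<delta> \<in> GL_A r" "\<delta> * \<gamma> = 1\<^sub>m r"
    using GL_A_inverse[OF \<gamma>(1)] by metis
  note carrier = \<beta>c GL_A_carrier[OF \<gamma>(1)] GL_A_carrier[OF \<delta>(1)]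
  \<comment> \<open>Divisibility by \<open>\<beta>\<close> thereby becomes divisibility by the
    chosen representative.\<close>
  have \<beta>_eq: "\<delta> * rep (GL_coset r \<beta>) = \<beta>"
    using \<gamma>(2) \<delta>(2) carrier by (simp add: assoc_mult_mat[of _ r r _ r _ r, symmetric])
  show ?thesis
  proof (intro bexI[of _ "GL_coset r \<beta>"] conjI ballI impI)
    show "GL_coset r \<beta> \<in> cosets r p" using \<beta>(1) by (simp add: cosets_def)
    show "kills_mod p (rep (GL_coset r \<beta>)) h"
      unfolding \<gamma>(2) using \<beta>(2) carrier hc by (intro kills_mod_mult)
  next
    fix \<alpha> assume "\<alpha> \<in> carrier_mat r r" "kills_mod p \<alpha> h"
    then obtain \<alpha>' where \<alpha>': "\<alpha>' \<in> carrier_mat r r" "\<alpha> = \<alpha>' * \<beta>"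
      using dvd by (auto simp: right_dvd_def)
    have "\<alpha> = (\<alpha>' * \<delta>) * rep (GL_coset r \<beta>)"
      using \<alpha>' carrier \<gamma>(2) \<beta>_eq by (simp add: assoc_mult_mat[of _ r r _ r _ r])
    then show "right_dvd r (rep (GL_coset r \<beta>)) \<alpha>"
      using \<alpha>'(1) carrier by (auto simp: right_dvd_def intro!: bexI[of _ "\<alpha>' * \<delta>"])
  next
    fix D assume D: "D \<in> cosets r p" "kills_mod p (rep D) h"
    then obtain \<delta>' where \<delta>': "\<delta>' \<in> carrier_mat r r" "rep D = \<delta>' * \<beta>"
      using dvd[OF rep_carrier] by (auto simp: right_dvd_def)
    \<comment> \<open>Both matrices have determinant \<open>p\<close> up to units, so the quotient
      has unit determinant.\<close>
    then have "\<delta>' \<in> GL_A r"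
      using det_class_cancel[of \<delta>' \<beta> r 1 p] rep_det_class[OF D(1)] \<beta>(1) p0 by (simp add: GL_A_eq)
    then have "GL_coset r (rep D) = GL_coset r \<beta>"
      using GL_coset_mult[OF _ \<beta>c] \<delta>'(2) by simp
    then show "D = GL_coset r \<beta>" using GL_coset_rep[OF D(1)] by simp
  qed
qed

lemma dvd_det_det_class: "\<alpha> \<in> det_class r (N * p) \<Longrightarrow> p dvd det \<alpha>"
  by (auto simp: det_class_def dvd_smult)

text \<open>The divisor is the coset attached to a nonzero kernel vector of \<open>\<alpha>\<close>
  modulo \<open>p\<close>.\<close>

lemma ex_irreducible_right_divisor:
  fixes p :: "'q::{finite, field} poly"
  assumes p: "Factorial_Ring.irreducible p" and \<alpha>: "\<alpha> \<in> carrier_mat r r" "p dvd det \<alpha>"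
  obtains C where "C \<in> cosets r p" "right_dvd r (rep C) \<alpha>"
proof -
  obtain h where h: "h \<in> residue_vecs r p" "h \<noteq> 0\<^sub>v r" "kills_mod p \<alpha> h"
    using ex_kills_mod[OF p \<alpha>] by auto
  show thesis
    using coset_killing[OF p h(1,2)] that \<alpha>(1) h(3) by blast
qed

text \<open>A coset is determined by any nonzero residue vector that it kills, and there are
  finitely many of these.\<close>

lemma finite_cosets_irreducible:
  fixes p :: "'q::{finite, field} poly"
  assumes p: "Factorial_Ring.irreducible p"
  shows "finite (cosets r p)"
proof (rule finite_subset)
  have p0: "p \<noteq> 0" using p by auto
  \<comment> \<open>Every coset kills the zero vector, so the value there may be arbitrary; only
    nonzero \<open>h\<close> serve as preimages.\<close>
  let ?f = "\<lambda>h. THE C. C \<in> cosets r p \<and> kills_mod p (rep C) h"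
  show "cosets r p \<subseteq> ?f ` residue_vecs r p"
  proof
    fix C assume C: "C \<in> cosets r p"
    then have "p dvd det (rep C)"
      using dvd_det_det_class[of "rep C" r 1 p] rep_det_class[OF C] by simp
    then obtain h where h: "h \<in> residue_vecs r p" "h \<noteq> 0\<^sub>v r" "kills_mod p (rep C) h"
      using ex_kills_mod[OF p rep_carrier[OF C]] by auto
    then have "?f h = C"
      using coset_killing[OF p h(1,2)] C h(3) by (intro the_equality) blast+
    then show "C \<in> ?f ` residue_vecs r p" using h(1) by blast
  qed
  show "finite (?f ` residue_vecs r p)" using finite_residue_vecs[OF p0] by simp
qed

text \<open>A nonconstant reducible polynomial is a product of two factors of smaller degree, so
  induction on the degree applies. Multiplicative statements are thus reduced to constants and
  irreducibles.\<close>

lemma poly_mult_induct [consumes 1, case_names const irreducible mult]: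
  fixes M :: "'q::field poly"
  assumes "M \<noteq> 0" and "\<And>c. c \<noteq> 0 \<Longrightarrow> P [:c:]" and "\<And>p. Factorial_Ring.irreducible p \<Longrightarrow> P p"
    and "\<And>a b. a \<noteq> 0 \<Longrightarrow> b \<noteq> 0 \<Longrightarrow> P a \<Longrightarrow> P b \<Longrightarrow> P (a * b)"
  shows "P M"
  using assms(1)
proof (induction "degree M" arbitrary: M rule: less_induct)
  case less
  show ?case
  proof (cases "degree M = 0")
    case True
    then obtain c where "M = [:c:]" by (rule degree_eq_zeroE)
    then show ?thesis using assms(2) less.prems by auto
  next
    case deg: False
    show ?thesis
    proof (cases "Factorial_Ring.irreducible M")
      case False
      have "\<not> M dvd 1" using deg by (auto simp: is_unit_iff_degree less.prems)
      then obtain a b where ab: "M = a * b" "\<not> a dvd 1" "\<not> b dvd 1"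
        using False less.prems by (auto simp: Factorial_Ring.irreducible_def)
      then have nz: "a \<noteq> 0" "b \<noteq> 0" using less.prems by auto
      then have "degree a > 0" "degree b > 0"
        using ab by (auto simp: is_unit_iff_degree)
      then have "degree a < degree M" "degree b < degree M"
        using nz ab(1) by (auto simp: degree_mult_eq)
      then show ?thesis using less.hyps nz assms(4) ab(1) by blast
    qed (use assms(3) in blast)
  qed
qed

section \<open>Finiteness of the sets of cosets\<close>

lemma cosets_smult: "c \<noteq> 0 \<Longrightarrow> cosets r (smult c N) = cosets r N"
  by (simp add: cosets_def det_class_smult)

lemma cosets_one: "cosets r 1 = {GL_A r}"
proof -
  have "GL_coset r \<gamma> = GL_A r" if "\<gamma> \<in> GL_A r" for \<gamma> :: "'a poly mat"
  proof -
    have "\<gamma>' * 1\<^sub>m r = \<gamma>'" if "\<gamma>' \<in> GL_A r" for \<gamma>' :: "'a poly mat"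
      using GL_A_carrier[OF that] by simp
    then have "(\<lambda>\<gamma>'. \<gamma>' * 1\<^sub>m r) ` GL_A r = (GL_A r :: 'a poly mat set)" by simp
    moreover have "GL_coset r (1\<^sub>m r :: 'a poly mat) = (\<lambda>\<gamma>'. \<gamma>' * 1\<^sub>m r) ` GL_A r"
      by (auto simp: GL_coset_def)
    ultimately have "GL_coset r (1\<^sub>m r :: 'a poly mat) = GL_A r" by simp
    then show ?thesis
      using GL_coset_mult[OF that one_carrier_mat] GL_A_carrier[OF that] by simp
  qed
  then show ?thesis
    using GL_A_one[of r] unfolding cosets_def GL_A_eq[symmetric] by blast
qed

text \<open>Splitting off an irreducible right divisor writes each coset of determinant
  \<open>N * p\<close> as a product of a coset for \<open>N\<close> and one for
  \<open>p\<close>.\<close>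

lemma finite_cosets:
  fixes N :: "'q::{finite, field} poly"
  assumes "N \<noteq> 0"
  shows "finite (cosets r N)"
proof -
  \<comment> \<open>With an arbitrary left factor \<open>N\<close>, the case of a product is two
    successive applications; the claim itself is the instance with left factor 1.\<close>
  have "\<forall>N. finite (cosets r N) \<longrightarrow> finite (cosets r (N * M))" if "M \<noteq> 0" for M :: "'q poly"
    using that
  proof (induction M rule: poly_mult_induct)
    case (const c)
    then show ?case by (simp add: cosets_smult)
  next
    case (irreducible p)
    have p0: "p \<noteq> 0" using irreducible by auto
    show ?case
    proof (intro allI impI)
      fix N :: "'q poly" assume fin: "finite (cosets r N)"
      have "cosets r (N * p) \<subseteq> (\<lambda>(C, D). GL_coset r (rep C * rep D)) ` (cosets r N \<times> cosets r p)"
      proof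
        fix E assume E: "E \<in> cosets r (N * p)"
        obtain D where D: "D \<in> cosets r p" "right_dvd r (rep D) (rep E)"
          using ex_irreducible_right_divisor[OF irreducible rep_carrier[OF E]]
            dvd_det_det_class[OF rep_det_class[OF E]] by metis
        have "E \<in> (\<lambda>C. GL_coset r (rep C * rep D)) ` cosets r N"
          using bij_betw_cosets_mult[OF rep_det_class[OF D(1)] p0, of N] E D(2)
          by (auto simp: bij_betw_def)
        then show "E \<in> (\<lambda>(C, D). GL_coset r (rep C * rep D)) ` (cosets r N \<times> cosets r p)"
          using D(1) by auto
      qed
      then show "finite (cosets r (N * p))"
        using fin finite_cosets_irreducible[OF irreducible] by (auto intro: finite_subset)
    qed
  next
    case (mult a b)
    then show ?case by (metis mult.assoc)
  qed
  from this[OF assms] have "finite (cosets r (1 * N))"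
    by (simp add: cosets_one del: mult_1)
  then show ?thesis by simp
qed

text \<open>
  Every nonzero residue vector killed by \<open>\<alpha>\<close> is killed by exactly one right divisor of \<open>\<alpha>\<close> of
  determinant \<open>p\<close>, and each of these kernels has \<open>-1\<close> nonzero elements modulo the cardinality of \<open>'q\<close>.
\<close>
lemma card_irreducible_right_divisors:
  fixes p :: "'q::{finite, field} poly"
  assumes p: "Factorial_Ring.irreducible p" and \<alpha>: "\<alpha> \<in> carrier_mat r r" "p dvd det \<alpha>"
    and char: "of_nat CARD('q) = (0 :: 'c::comm_ring_1)"
  shows "of_nat (card {C \<in> cosets r p. right_dvd r (rep C) \<alpha>}) = (1 :: 'c)"
proof -
  have p0: "p \<noteq> 0" using p by auto
  \<comment> \<open>The zero vector is removed because every matrix kills it, which would spoil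
    disjointness.\<close>
  define K where "K \<beta> = {h \<in> residue_vecs r p. kills_mod p \<beta> h} - {0\<^sub>v r}" for \<beta>
  define \<C> where "\<C> = {C \<in> cosets r p. right_dvd r (rep C) \<alpha>}"
  have finK: "finite (K \<beta>)" for \<beta>
    unfolding K_def by (rule finite_subset[OF _ finite_residue_vecs[OF p0, of r]]) auto
  have card_K: "of_nat (card (K \<beta>)) = (- 1 :: 'c)" if \<beta>: "\<beta> \<in> carrier_mat r r" "p dvd det \<beta>" for \<beta>
  proof -
    have "card {h \<in> residue_vecs r p. kills_mod p \<beta> h} = Suc (card (K \<beta>))"
      unfolding K_def using zero_in_residue_vecs kills_mod_zero[OF \<beta>(1)] finite_residue_vecs[OF p0]
      by (intro card.remove) auto
    moreover obtain n where "card {h \<in> residue_vecs r p. kills_mod p \<beta> h} = CARD('q) * n"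
      using card_kernel_dvd[OF p \<beta>] by (rule dvdE)
    ultimately have "of_nat (Suc (card (K \<beta>))) = (of_nat (CARD('q) * n) :: 'c)" by simp
    then show ?thesis using char by (simp add: add_eq_0_iff)
  qed
  have "K \<alpha> = (\<Union>C\<in>\<C>. K (rep C))"
  proof (intro equalityI subsetI)
    fix h assume h: "h \<in> K \<alpha>"
    then obtain C where "C \<in> cosets r p" "kills_mod p (rep C) h" "right_dvd r (rep C) \<alpha>"
      using coset_killing[OF p, of h r] \<alpha>(1) unfolding K_def by blast
    then show "h \<in> (\<Union>C\<in>\<C>. K (rep C))"
      using h by (auto simp: K_def \<C>_def)
  next
    fix h assume "h \<in> (\<Union>C\<in>\<C>. K (rep C))"
    then obtain C where C: "C \<in> cosets r p" "right_dvd r (rep C) \<alpha>" and h: "h \<in> K (rep C)"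
      by (auto simp: \<C>_def)
    have "h \<in> carrier_vec r" "kills_mod p (rep C) h"
      using h by (auto simp: K_def residue_vecs_def)
    then have "kills_mod p \<alpha> h"
      by (rule kills_mod_right_dvd[OF C(2) rep_carrier[OF C(1)]])
    then show "h \<in> K \<alpha>"
      using h by (auto simp: K_def)
  qed
  moreover have "K (rep C) \<inter> K (rep D) = {}" if "C \<in> \<C>" "D \<in> \<C>" "C \<noteq> D" for C D
  proof (rule ccontr)
    assume "K (rep C) \<inter> K (rep D) \<noteq> {}"
    then obtain h where "h \<in> residue_vecs r p" "h \<noteq> 0\<^sub>v r" "kills_mod p (rep C) h" "kills_mod p (rep D) h"
      by (auto simp: K_def)
    then show False
      using coset_killing[OF p, of h r] that unfolding \<C>_def by blast
  qed
  moreover have fin: "finite \<C>"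
    using finite_cosets_irreducible[OF p] by (simp add: \<C>_def)
  ultimately have "card (K \<alpha>) = (\<Sum>C\<in>\<C>. card (K (rep C)))"
    using finK by (simp add: card_UN_disjoint)
  then have "of_nat (card (K \<alpha>)) = (\<Sum>C\<in>\<C>. of_nat (card (K (rep C))) :: 'c)" by simp
  also have "\<dots> = (\<Sum>C\<in>\<C>. - 1)"
  proof (rule sum.cong)
    fix C assume "C \<in> \<C>"
    then have C: "C \<in> cosets r p" by (simp add: \<C>_def)
    show "of_nat (card (K (rep C))) = (- 1 :: 'c)"
      using card_K[OF rep_carrier[OF C]] dvd_det_det_class[of "rep C" r 1 p] rep_det_class[OF C] by simp
  qed simp
  \<comment> \<open>Both sides are now known in \<open>'c\<close>: \<open>- 1\<close> equals the
    number of divisors times \<open>- 1\<close>.\<close>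
  finally show ?thesis
    using card_K[OF \<alpha>] by (simp add: \<C>_def)
qed

subsection \<open>Double cosets\<close>

lemma hecke_double_cosets_eq:
  assumes "N \<noteq> 0"
  shows "hecke_double_cosets r N = double_coset r ` det_class r N"
proof -
  have "{\<alpha> \<in> S_A r. \<exists>c. c \<noteq> 0 \<and> det \<alpha> = smult c N} = det_class r N"
    using assms by (auto simp: S_A_def det_class_def)
  then show ?thesis by (simp add: hecke_double_cosets_def)
qed

lemma double_coset_self: "\<alpha> \<in> carrier_mat r r \<Longrightarrow> \<alpha> \<in> double_coset r \<alpha>"
  using GL_A_one[of r] by (auto simp: double_coset_def intro!: exI[of _ "1\<^sub>m r"])

lemma double_coset_carrier: "\<beta> \<in> double_coset r \<alpha> \<Longrightarrow> \<alpha> \<in> carrier_mat r r \<Longrightarrow> \<beta> \<in> carrier_mat r r"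
  by (auto simp: double_coset_def intro!: mult_carrier_mat dest: GL_A_carrier)

lemma double_coset_mult:
  assumes "\<gamma> \<in> GL_A r" "\<delta> \<in> GL_A r" "\<alpha> \<in> carrier_mat r r" "\<beta> \<in> double_coset r \<alpha>"
  shows "\<gamma> * \<beta> * \<delta> \<in> double_coset r \<alpha>"
proof -
  obtain \<gamma>' \<delta>' where *: "\<gamma>' \<in> GL_A r" "\<delta>' \<in> GL_A r" "\<beta> = \<gamma>' * \<alpha> * \<delta>'"
    using assms(4) by (auto simp: double_coset_def)
  note carrier = assms(3) assms(1,2)[THEN GL_A_carrier] *(1,2)[THEN GL_A_carrier]
  have "\<gamma> * \<beta> * \<delta> = (\<gamma> * \<gamma>') * \<alpha> * (\<delta>' * \<delta>)"
    unfolding *(3) using carrier by (simp add: assoc_mult_mat[of _ r r _ r _ r] mult_carrier_mat[of _ r r _ r])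
  then show ?thesis
    using GL_A_mult[OF assms(1) *(1)] GL_A_mult[OF *(2) assms(2)] by (auto simp: double_coset_def)
qed

lemma double_coset_eq:
  assumes \<alpha>: "\<alpha> \<in> carrier_mat r r" and \<beta>: "\<beta> \<in> double_coset r \<alpha>"
  shows "double_coset r \<beta> = double_coset r \<alpha>"
proof (intro equalityI subsetI)
  fix x assume "x \<in> double_coset r \<beta>"
  then show "x \<in> double_coset r \<alpha>"
    using double_coset_mult[OF _ _ \<alpha> \<beta>] by (auto simp: double_coset_def[of r \<beta>])
next
  note \<beta>c = double_coset_carrier[OF \<beta> \<alpha>]
  obtain \<gamma> \<delta> where *: "\<gamma> \<in> GL_A r" "\<delta> \<in> GL_A r" "\<beta> = \<gamma> * \<alpha> * \<delta>"
    using \<beta> by (auto simp: double_coset_def)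
  obtain \<gamma>' \<delta>' where inv: "\<gamma>' \<in> GL_A r" "\<gamma>' * \<gamma> = 1\<^sub>m r" "\<delta>' \<in> GL_A r" "\<delta> * \<delta>' = 1\<^sub>m r"
    using GL_A_inverse[OF *(1)] GL_A_inverse[OF *(2)] by metis
  have "\<gamma>' * \<beta> * \<delta>' = (\<gamma>' * \<gamma>) * \<alpha> * (\<delta> * \<delta>')"
    unfolding *(3) using \<alpha> *(1,2)[THEN GL_A_carrier] inv(1,3)[THEN GL_A_carrier]
    by (simp add: assoc_mult_mat[of _ r r _ r _ r] mult_carrier_mat[of _ r r _ r])
  then have "\<alpha> = \<gamma>' * \<beta> * \<delta>'" using inv \<alpha> by simp
  then have "\<alpha> \<in> double_coset r \<beta>" using inv by (auto simp: double_coset_def)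
  fix x assume "x \<in> double_coset r \<alpha>"
  then show "x \<in> double_coset r \<beta>"
    using double_coset_mult[OF _ _ \<beta>c \<open>\<alpha> \<in> double_coset r \<beta>\<close>] by (auto simp: double_coset_def[of r \<alpha>])
qed

text \<open>Distinct double cosets are disjoint unions of cosets and share none, so the iterated sum
  runs over a partition.\<close>

lemma sum_hecke_double_cosets:
  fixes F :: "'q::{finite, field} poly mat set \<Rightarrow> 'c::comm_monoid_add"
  assumes N: "N \<noteq> 0"
  shows "(\<Sum>D\<in>hecke_double_cosets r N. \<Sum>C\<in>GL_coset r ` D. F C) = (\<Sum>C\<in>cosets r N. F C)"
proof -
  let ?H = "hecke_double_cosets r N"
  have sub: "D \<subseteq> det_class r N" if "D \<in> ?H" for D
  proof
    fix \<beta> assume "\<beta> \<in> D"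
    then obtain \<alpha> \<gamma> \<delta> where "\<alpha> \<in> det_class r N" "\<gamma> \<in> det_class r 1" "\<delta> \<in> det_class r 1" "\<beta> = \<gamma> * \<alpha> * \<delta>"
      using \<open>D \<in> ?H\<close> by (auto simp: hecke_double_cosets_eq[OF N] double_coset_def GL_A_eq)
    then show "\<beta> \<in> det_class r N"
      using det_class_mult[of "\<gamma> * \<alpha>" r N \<delta> 1] det_class_mult[of \<gamma> r 1 \<alpha> N] by simp
  qed
  have eq: "D = double_coset r \<beta>" if "D \<in> ?H" "\<beta> \<in> D" for D \<beta>
  proof -
    obtain \<alpha> where \<alpha>: "\<alpha> \<in> det_class r N" "D = double_coset r \<alpha>"
      using \<open>D \<in> ?H\<close> by (auto simp: hecke_double_cosets_eq[OF N])
    then show ?thesis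
      using double_coset_eq[OF det_class_carrier[OF \<alpha>(1)], of \<beta>] \<open>\<beta> \<in> D\<close> by blast
  qed
  have disjoint: "D = D'" if DD': "D \<in> ?H" "D' \<in> ?H" "C \<in> GL_coset r ` D" "C \<in> GL_coset r ` D'" for D D' C
  proof -
    obtain \<beta> \<beta>' where \<beta>: "\<beta> \<in> D" "\<beta>' \<in> D'" "GL_coset r \<beta> = GL_coset r \<beta>'"
      using DD' by auto
    have carrier: "\<beta> \<in> carrier_mat r r" "\<beta>' \<in> carrier_mat r r"
      using sub DD'(1,2) \<beta>(1,2) det_class_carrier by blast+
    obtain \<gamma> where \<gamma>: "\<gamma> \<in> GL_A r" "\<beta> = \<gamma> * \<beta>'"
      using GL_coset_eq_imp[OF carrier(1) \<beta>(3)] by metis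
    have "\<beta> \<in> double_coset r \<beta>'"
      using double_coset_mult[OF \<gamma>(1) GL_A_one carrier(2) double_coset_self[OF carrier(2)]] \<gamma>(2) carrier by simp
    then show ?thesis
      using eq[OF DD'(1) \<beta>(1)] eq[OF DD'(2) \<beta>(2)] double_coset_eq[OF carrier(2)] by simp
  qed
  have nonempty: "D \<noteq> {}" if "D \<in> ?H" for D
    using that double_coset_self[OF det_class_carrier] unfolding hecke_double_cosets_eq[OF N] by blast
  \<comment> \<open>A double coset is determined by its set of cosets, a subset of the finite
    \<open>cosets r N\<close>. This yields the finiteness of \<open>?H\<close>, without which the
    outer sum would be 0 by convention.\<close>
  have "inj_on (image (GL_coset r)) ?H"
  proof (rule inj_onI)
    fix D D' assume DD': "D \<in> ?H" "D' \<in> ?H" "GL_coset r ` D = GL_coset r ` D'"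
    obtain \<beta> where "\<beta> \<in> D" using nonempty[OF DD'(1)] by blast
    then show "D = D'" using disjoint[OF DD'(1,2), of "GL_coset r \<beta>"] DD'(3) by blast
  qed
  moreover have "image (GL_coset r) ` ?H \<subseteq> Pow (cosets r N)"
    using sub by (auto simp: cosets_def)
  ultimately have finite: "finite ?H"
    using finite_cosets[OF N, of r] by (meson finite_Pow_iff finite_imageD finite_subset)
  have union: "(\<Union>D\<in>?H. GL_coset r ` D) = cosets r N"
  proof
    show "(\<Union>D\<in>?H. GL_coset r ` D) \<subseteq> cosets r N"
      using sub by (auto simp: cosets_def)
    show "cosets r N \<subseteq> (\<Union>D\<in>?H. GL_coset r ` D)"
      using double_coset_self[OF det_class_carrier] unfolding cosets_def hecke_double_cosets_eq[OF N] by blast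
  qed
  have "finite (GL_coset r ` D)" if "D \<in> ?H" for D
    using that union finite_cosets[OF N, of r] by (metis UN_upper finite_subset)
  moreover have "\<forall>D\<in>?H. \<forall>D'\<in>?H. D \<noteq> D' \<longrightarrow> GL_coset r ` D \<inter> GL_coset r ` D' = {}"
    using disjoint by blast
  ultimately have "(\<Sum>C\<in>(\<Union>D\<in>?H. GL_coset r ` D). F C) = (\<Sum>D\<in>?H. \<Sum>C\<in>GL_coset r ` D. F C)"
    using finite by (intro sum.UNION_disjoint) blast+
  then show ?thesis using union by simp
qed


subsection \<open>The action on the Drinfeld symmetric space\<close>

text \<open>Evaluation at \<open>t\<close>, which is \<open>fls_X_inv\<close>: the part of
  \<open>emb_A\<close> that stays inside the Laurent series.\<close>

definition poly_fls :: "'q::{finite, field} poly \<Rightarrow> 'q fls" where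
  "poly_fls a = poly (map_poly fls_const a) fls_X_inv"

lemma poly_fls_0 [simp]: "poly_fls 0 = 0"
  by (simp add: poly_fls_def)

lemma poly_fls_pCons: "poly_fls (pCons c a) = fls_const c + fls_X_inv * poly_fls a"
  by (simp add: poly_fls_def map_poly_pCons)

lemma poly_fls_add: "poly_fls (a + b) = poly_fls a + poly_fls b"
  by (induction a b rule: poly_induct2) (simp_all add: poly_fls_pCons fls_plus_const[symmetric] algebra_simps)

lemma poly_fls_smult: "poly_fls (smult c a) = fls_const c * poly_fls a"
proof (induction a)
  case (pCons d a)
  then show ?case
    by (simp add: poly_fls_pCons algebra_simps)
qed simp

lemma poly_fls_mult: "poly_fls (a * b) = poly_fls a * poly_fls b"
proof (induction a)
  case (pCons c a)
  then show ?case
    by (simp add: poly_fls_pCons poly_fls_add poly_fls_smult algebra_simps)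
qed simp

text \<open>The index is negative because the series variable is \<open>1/t\<close>. The
  coefficients can be recovered, whence injectivity.\<close>

lemma poly_fls_nth: "fls_nth (poly_fls a) (- int n) = coeff a n"
proof -
  have "poly_fls a = (\<Sum>i\<le>degree (map_poly fls_const a). fls_const (coeff a i) * fls_X_inv ^ i)"
    unfolding poly_fls_def by (simp add: poly_altdef coeff_map_poly)
  also have "degree (map_poly fls_const a) = degree a"
    by (rule degree_map_poly) auto
  finally have "fls_nth (poly_fls a) (- int n) = (\<Sum>i\<le>degree a. if i = n then coeff a i else 0)"
    by (simp add: fls_nth_sum if_distrib cong: if_cong)
  also have "\<dots> = coeff a n"
    by (simp add: coeff_eq_0)
  finally show ?thesis .
qed

lemma inj_comm_ring_hom_poly_fls: "inj_comm_ring_hom poly_fls"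
proof
  show "poly_fls 1 = 1" by (simp add: one_pCons poly_fls_pCons)
  fix a :: "'q::{finite, field} poly" assume "poly_fls a = 0"
  then have "coeff a n = 0" for n using poly_fls_nth[of a n] by simp
  then show "a = 0" by (simp add: poly_eq_iff)
qed (simp_all add: poly_fls_add poly_fls_mult)

text \<open>Translation by 1 permutes the finite ring, so it leaves the sum of all elements
  unchanged.\<close>

lemma of_nat_card_eq_0: "of_nat CARD('q) = (0 :: 'q::{finite, ring_1})"
proof -
  have "(\<Sum>x\<in>UNIV. x) = (\<Sum>x\<in>UNIV. x + (1 :: 'q))"
    by (rule sum.reindex_bij_betw[symmetric]) (auto intro!: bijI injI simp: surj_def intro: exI[of _ "_ - 1"])
  also have "\<dots> = (\<Sum>x\<in>UNIV. x) + of_nat CARD('q)"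
    by (simp add: sum.distrib)
  finally show ?thesis by simp
qed

text \<open>Normalising the last entry only scales a vector, and the scalar passes through
  \<open>\<alpha>\<close>; this gives the cocycle relation and the action law.\<close>

lemma moebius_act_mult:
  assumes carrier: "\<alpha> \<in> carrier_mat r r" "\<beta> \<in> carrier_mat r r" "\<omega> \<in> carrier_vec r"
    and r: "r > 0" and nz: "aut_factor r \<beta> \<omega> \<noteq> 0"
  shows aut_factor_mult: "aut_factor r (\<alpha> * \<beta>) \<omega> = aut_factor r \<alpha> (moebius_act r \<beta> \<omega>) * aut_factor r \<beta> \<omega>"
    and "moebius_act r (\<alpha> * \<beta>) \<omega> = moebius_act r \<alpha> (moebius_act r \<beta> \<omega>)"
proof -
  let ?j = "aut_factor r \<beta> \<omega>" and ?v = "(\<alpha> * \<beta>) *\<^sub>v \<omega>"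
  have act: "\<alpha> *\<^sub>v moebius_act r \<beta> \<omega> = inverse ?j \<cdot>\<^sub>v ?v"
    unfolding moebius_act_def using carrier by (simp add: mult_mat_vec[of _ r r])
  then have aut: "aut_factor r \<alpha> (moebius_act r \<beta> \<omega>) = inverse ?j * aut_factor r (\<alpha> * \<beta>) \<omega>"
    unfolding aut_factor_def act using carrier_matD(1)[OF carrier(1)] r by simp
  then show "aut_factor r (\<alpha> * \<beta>) \<omega> = aut_factor r \<alpha> (moebius_act r \<beta> \<omega>) * ?j"
    using nz by simp
  have "inverse (inverse ?j * a) * inverse ?j = inverse a" for a
    using nz by (simp add: inverse_mult_distrib)
  then show "moebius_act r (\<alpha> * \<beta>) \<omega> = moebius_act r \<alpha> (moebius_act r \<beta> \<omega>)"
    unfolding moebius_act_def[of r \<alpha>] moebius_act_def[of r "\<alpha> * \<beta>"] act aut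
    by (simp only: smult_smult_assoc)
qed

lemma slash_mult:
  assumes "\<alpha> \<in> carrier_mat r r" "\<beta> \<in> carrier_mat r r" "\<omega> \<in> carrier_vec r"
    and "r > 0" and "aut_factor r \<beta> \<omega> \<noteq> 0"
  shows "slash r k f (\<alpha> * \<beta>) \<omega> = slash r k (slash r k f \<alpha>) \<beta> \<omega>"
  by (simp add: slash_def moebius_act_mult[OF assms] power_int_mult_distrib)

section \<open>Matrices over \<open>A\<close> acting on functions with values in
  \<open>'c\<close>\<close>

locale drinfeld_setting =
  fixes \<iota> :: "'q::{finite, field} fls alg_closure \<Rightarrow> 'c::{field, complete_space}"
    and r :: nat and k :: int
  assumes field_hom: "field_hom \<iota>" and r_pos: "r > 0"
begin

abbreviation emb_mat :: "'q poly mat \<Rightarrow> 'c mat" where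
  "emb_mat \<equiv> map_mat (emb_A \<iota>)"

definition invariant :: "('c vec \<Rightarrow> 'c) \<Rightarrow> bool" where
  "invariant f \<longleftrightarrow> (\<forall>\<gamma>\<in>GL_A r. \<forall>\<omega>\<in>Omega \<iota> r. slash r k f (emb_mat \<gamma>) \<omega> = f \<omega>)"

lemma inj_comm_ring_hom_emb_inf: "inj_comm_ring_hom (emb_inf \<iota>)"
proof -
  interpret field_hom \<iota> by (rule field_hom)
  show ?thesis
    by unfold_locales (simp_all add: emb_inf_def hom_distribs)
qed

lemma emb_A_eq: "emb_A \<iota> a = emb_inf \<iota> (poly_fls a)"
  by (simp add: emb_A_def poly_fls_def)

lemma comm_ring_hom_emb_A: "comm_ring_hom (emb_A \<iota>)"
proof -
  interpret i: inj_comm_ring_hom "emb_inf \<iota>" by (rule inj_comm_ring_hom_emb_inf)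
  interpret p: inj_comm_ring_hom "poly_fls :: 'q poly \<Rightarrow> 'q fls" by (rule inj_comm_ring_hom_poly_fls)
  show ?thesis
    by unfold_locales (simp_all add: emb_A_eq hom_distribs)
qed

text \<open>This turns a multiplicity congruent to 1 modulo \<open>CARD('q)\<close> into the scalar
  1.\<close>

lemma of_nat_card_C: "of_nat CARD('q) = (0 :: 'c)"
proof -
  interpret comm_ring_hom "emb_A \<iota>" by (rule comm_ring_hom_emb_A)
  have "of_nat CARD('q) = (0 :: 'q poly)"
    by (simp add: of_nat_poly of_nat_card_eq_0)
  then show ?thesis using hom_of_nat[of "CARD('q)"] by simp
qed

lemma E_carrier: "\<alpha> \<in> carrier_mat r r \<Longrightarrow> emb_mat \<alpha> \<in> carrier_mat r r"
  by simp

lemma E_mult: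
  assumes "\<alpha> \<in> carrier_mat r r" "\<beta> \<in> carrier_mat r r"
  shows "emb_mat (\<alpha> * \<beta>) = emb_mat \<alpha> * emb_mat \<beta>"
proof -
  interpret comm_ring_hom "emb_A \<iota>" by (rule comm_ring_hom_emb_A)
  show ?thesis using assms by (rule mat_hom_mult)
qed

lemma Omega_carrier: "\<omega> \<in> Omega \<iota> r \<Longrightarrow> \<omega> \<in> carrier_vec r"
  by (simp add: Omega_def)

text \<open>A linear form \<open>c\<close> on the image of \<open>\<omega>\<close> is the form with
  the transpose of \<open>\<alpha>\<close> applied to \<open>c\<close> on \<open>\<omega>\<close>
  itself. Independence of the entries of \<open>\<omega>\<close> kills the latter, and the nonzero
  determinant then kills \<open>c\<close>.\<close>

lemma linear_form_E:
  assumes \<alpha>: "\<alpha> \<in> carrier_mat r r" "det \<alpha> \<noteq> 0" and \<omega>: "\<omega> \<in> Omega \<iota> r"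
    and zero: "(\<Sum>i<r. emb_inf \<iota> (c i) * (emb_mat \<alpha> *\<^sub>v \<omega>) $ i) = 0" and i: "i < r"
  shows "c i = 0"
proof -
  interpret i: inj_comm_ring_hom "emb_inf \<iota>" by (rule inj_comm_ring_hom_emb_inf)
  interpret p: inj_comm_ring_hom "poly_fls :: 'q poly \<Rightarrow> 'q fls" by (rule inj_comm_ring_hom_poly_fls)
  define B where "B = map_mat poly_fls \<alpha>"
  have B: "B \<in> carrier_mat r r" using \<alpha> by (simp add: B_def)
  have detB: "det (transpose_mat B) \<noteq> 0"
    using \<alpha> B by (simp add: det_transpose[OF B]) (simp add: B_def)
  have "(\<Sum>i<r. emb_inf \<iota> (c i) * (emb_mat \<alpha> *\<^sub>v \<omega>) $ i)
      = (\<Sum>i<r. \<Sum>l<r. emb_inf \<iota> (c i * B $$ (i, l)) * \<omega> $ l)"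
    using \<alpha>(1) Omega_carrier[OF \<omega>]
    by (intro sum.cong refl) (simp add: scalar_prod_def sum_distrib_left emb_A_eq B_def
        hom_distribs mult.assoc atLeast0LessThan)
  also have "\<dots> = (\<Sum>l<r. emb_inf \<iota> (\<Sum>i<r. c i * B $$ (i, l)) * \<omega> $ l)"
    unfolding i.hom_sum sum_distrib_right by (rule sum.swap)
  finally have form: "(\<Sum>l<r. emb_inf \<iota> (\<Sum>i<r. c i * B $$ (i, l)) * \<omega> $ l) = 0"
    using zero by simp
  have independent: "\<forall>l<r. d l = 0" if "(\<Sum>l<r. emb_inf \<iota> (d l) * \<omega> $ l) = 0" for d
    using \<omega> that by (simp add: Omega_def)
  have "\<forall>l<r. (\<Sum>i<r. c i * B $$ (i, l)) = 0"
    by (rule independent[OF form])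
  then have "transpose_mat B *\<^sub>v vec r c = 0\<^sub>v r"
    using B by (intro eq_vecI) (auto simp: scalar_prod_def atLeast0LessThan mult.commute)
  then have "vec r c = 0\<^sub>v r"
    using det_0_iff_vec_prod_zero_field[of "transpose_mat B" r] detB B by (metis transpose_carrier_mat vec_carrier)
  then show ?thesis using i by (metis index_vec index_zero_vec(1))
qed

text \<open>The factor is the value of the last coordinate form, which is not the zero form.\<close>

lemma aut_factor_nonzero:
  assumes \<alpha>: "\<alpha> \<in> carrier_mat r r" "det \<alpha> \<noteq> 0" and \<omega>: "\<omega> \<in> Omega \<iota> r"
  shows "aut_factor r (emb_mat \<alpha>) \<omega> \<noteq> 0"
proof
  interpret i: inj_comm_ring_hom "emb_inf \<iota>" by (rule inj_comm_ring_hom_emb_inf)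
  assume "aut_factor r (emb_mat \<alpha>) \<omega> = 0"
  moreover have "(\<Sum>i<r. emb_inf \<iota> (if i = r - 1 then 1 else 0) * (emb_mat \<alpha> *\<^sub>v \<omega>) $ i)
      = (\<Sum>i<r. if i = r - 1 then (emb_mat \<alpha> *\<^sub>v \<omega>) $ i else 0)"
    by (intro sum.cong) auto
  moreover have "\<dots> = aut_factor r (emb_mat \<alpha>) \<omega>"
    using r_pos by (simp add: aut_factor_def)
  ultimately have "(if r - 1 = r - 1 then 1 else 0 :: 'q fls) = 0"
    using linear_form_E[OF \<alpha> \<omega>, of "\<lambda>i. if i = r - 1 then 1 else 0" "r - 1"] r_pos by simp
  then show False by simp
qed

lemma moebius_act_Omega:
  assumes \<alpha>: "\<alpha> \<in> carrier_mat r r" "det \<alpha> \<noteq> 0" and \<omega>: "\<omega> \<in> Omega \<iota> r"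
  shows "moebius_act r (emb_mat \<alpha>) \<omega> \<in> Omega \<iota> r"
proof -
  let ?j = "aut_factor r (emb_mat \<alpha>) \<omega>"
  have nz: "?j \<noteq> 0" by (rule aut_factor_nonzero[OF assms])
  have v: "emb_mat \<alpha> *\<^sub>v \<omega> \<in> carrier_vec r" using \<alpha> Omega_carrier[OF \<omega>] by (simp add: mult_mat_vec_carrier[of _ r r])
  then have idx: "moebius_act r (emb_mat \<alpha>) \<omega> $ i = inverse ?j * (emb_mat \<alpha> *\<^sub>v \<omega>) $ i" if "i < r" for i
    using that carrier_matD(1)[OF \<alpha>(1)] by (simp add: moebius_act_def)
  have "moebius_act r (emb_mat \<alpha>) \<omega> $ (r - 1) = 1"
    using idx[of "r - 1"] r_pos nz by (simp add: aut_factor_def)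
  moreover have "c i = 0" if "(\<Sum>i<r. emb_inf \<iota> (c i) * moebius_act r (emb_mat \<alpha>) \<omega> $ i) = 0" "i < r" for c i
  proof (rule linear_form_E[OF assms _ that(2)])
    have "inverse ?j * (\<Sum>i<r. emb_inf \<iota> (c i) * (emb_mat \<alpha> *\<^sub>v \<omega>) $ i)
        = (\<Sum>i<r. emb_inf \<iota> (c i) * moebius_act r (emb_mat \<alpha>) \<omega> $ i)"
      unfolding sum_distrib_left by (intro sum.cong) (simp_all add: idx)
    then show "(\<Sum>i<r. emb_inf \<iota> (c i) * (emb_mat \<alpha> *\<^sub>v \<omega>) $ i) = 0"
      using that(1) nz by simp
  qed
  moreover have "moebius_act r (emb_mat \<alpha>) \<omega> \<in> carrier_vec r"
    using v by (simp add: moebius_act_def)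
  ultimately show ?thesis by (auto simp: Omega_def)
qed

lemma slash_E_mult:
  assumes \<alpha>: "\<alpha> \<in> carrier_mat r r" and \<beta>: "\<beta> \<in> carrier_mat r r" "det \<beta> \<noteq> 0" and \<omega>: "\<omega> \<in> Omega \<iota> r"
  shows "slash r k f (emb_mat (\<alpha> * \<beta>)) \<omega> = slash r k (slash r k f (emb_mat \<alpha>)) (emb_mat \<beta>) \<omega>"
  unfolding E_mult[OF \<alpha> \<beta>(1)]
  by (rule slash_mult[OF E_carrier[OF \<alpha>] E_carrier[OF \<beta>(1)] Omega_carrier[OF \<omega>] r_pos
        aut_factor_nonzero[OF \<beta> \<omega>]])

text \<open>The two matrices differ by a left factor in \<open>GL_A\<close>, which invariance
  absorbs at the image of \<open>\<omega>\<close> under \<open>\<alpha>\<close>, again a point of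
  \<open>Omega\<close>.\<close>

lemma slash_rep:
  assumes f: "invariant f" and \<alpha>: "\<alpha> \<in> carrier_mat r r" "det \<alpha> \<noteq> 0" and \<omega>: "\<omega> \<in> Omega \<iota> r"
  shows "slash r k f (emb_mat (rep (GL_coset r \<alpha>))) \<omega> = slash r k f (emb_mat \<alpha>) \<omega>"
proof -
  obtain \<gamma> where \<gamma>: "\<gamma> \<in> GL_A r" "rep (GL_coset r \<alpha>) = \<gamma> * \<alpha>"
    by (rule rep_GL_coset[OF \<alpha>(1)])
  have "slash r k f (emb_mat (rep (GL_coset r \<alpha>))) \<omega> = slash r k (slash r k f (emb_mat \<gamma>)) (emb_mat \<alpha>) \<omega>"
    unfolding \<gamma>(2) by (rule slash_E_mult[OF GL_A_carrier[OF \<gamma>(1)] \<alpha> \<omega>])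
  also have "\<dots> = slash r k f (emb_mat \<alpha>) \<omega>"
    unfolding slash_def[of r k _ "emb_mat \<alpha>"]
    using f \<gamma>(1) moebius_act_Omega[OF \<alpha> \<omega>] by (simp add: invariant_def)
  finally show ?thesis .
qed

subsection \<open>Composition of Hecke operators\<close>

lemma hecke_eq:
  assumes "N \<noteq> 0"
  shows "hecke \<iota> r k N f \<omega> = (\<Sum>C\<in>cosets r N. slash r k f (emb_mat (rep C)) \<omega>)"
  unfolding hecke_def double_coset_op_def rep_def[symmetric]
  by (rule sum_hecke_double_cosets[OF assms])

text \<open>Identities between functions are available only on \<open>Omega\<close>; they may be
  used under a Hecke operator because the matrices map \<open>Omega\<close> to itself.\<close>

lemma hecke_cong:
  assumes N: "N \<noteq> 0" and eq: "\<And>\<omega>. \<omega> \<in> Omega \<iota> r \<Longrightarrow> f \<omega> = g \<omega>" and \<omega>: "\<omega> \<in> Omega \<iota> r"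
  shows "hecke \<iota> r k N f \<omega> = hecke \<iota> r k N g \<omega>"
  unfolding hecke_eq[OF N]
proof (rule sum.cong)
  fix C assume C: "C \<in> cosets r N"
  have "moebius_act r (emb_mat (rep C)) \<omega> \<in> Omega \<iota> r"
    using moebius_act_Omega[OF rep_carrier[OF C] det_class_det_nz[OF rep_det_class[OF C] N] \<omega>] .
  then show "slash r k f (emb_mat (rep C)) \<omega> = slash r k g (emb_mat (rep C)) \<omega>"
    by (simp add: slash_def eq)
qed simp

text \<open>Slashing is a right action, so the terms become \<open>f\<close> slashed by
  \<open>rep C * \<beta>\<close>, and \<open>bij_betw_cosets_mult\<close> identifies these cosets.
  Unit \<open>\<beta>\<close> yields invariance, \<open>\<beta>\<close> of irreducible determinant
  the composition of operators.\<close>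

lemma slash_hecke:
  assumes f: "invariant f" and N: "N \<noteq> 0" and M: "M \<noteq> 0" and \<beta>: "\<beta> \<in> det_class r M"
    and \<omega>: "\<omega> \<in> Omega \<iota> r"
  shows "slash r k (hecke \<iota> r k N f) (emb_mat \<beta>) \<omega>
    = (\<Sum>C\<in>{C \<in> cosets r (N * M). right_dvd r \<beta> (rep C)}. slash r k f (emb_mat (rep C)) \<omega>)"
proof -
  note \<beta>' = det_class_carrier[OF \<beta>] det_class_det_nz[OF \<beta> M]
  have "slash r k (hecke \<iota> r k N f) (emb_mat \<beta>) \<omega>
      = (\<Sum>C\<in>cosets r N. slash r k (slash r k f (emb_mat (rep C))) (emb_mat \<beta>) \<omega>)"
    by (simp add: slash_def[of r k _ "emb_mat \<beta>"] hecke_eq[OF N] sum_distrib_left)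
  also have "\<dots> = (\<Sum>C\<in>cosets r N. slash r k f (emb_mat (rep (GL_coset r (rep C * \<beta>)))) \<omega>)"
  proof (rule sum.cong)
    fix C assume C: "C \<in> cosets r N"
    note C' = rep_carrier[OF C]
    have nz: "det (rep C * \<beta>) \<noteq> 0"
      using det_class_det_nz[OF rep_det_class[OF C] N] \<beta>' by (simp add: det_mult[OF C' \<beta>'(1)])
    show "slash r k (slash r k f (emb_mat (rep C))) (emb_mat \<beta>) \<omega> = slash r k f (emb_mat (rep (GL_coset r (rep C * \<beta>)))) \<omega>"
      unfolding slash_rep[OF f mult_carrier_mat[OF C' \<beta>'(1)] nz \<omega>]
      by (rule slash_E_mult[OF C' \<beta>' \<omega>, symmetric])
  qed simp
  also have "\<dots> = (\<Sum>C\<in>{C \<in> cosets r (N * M). right_dvd r \<beta> (rep C)}. slash r k f (emb_mat (rep C)) \<omega>)"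
    by (rule sum.reindex_bij_betw[OF bij_betw_cosets_mult[OF \<beta> M]])
  finally show ?thesis .
qed

lemma right_dvd_GL_A:
  assumes \<gamma>: "\<gamma> \<in> GL_A r" and \<alpha>: "\<alpha> \<in> carrier_mat r r"
  shows "right_dvd r \<gamma> \<alpha>"
proof -
  obtain \<delta> where \<delta>: "\<delta> \<in> GL_A r" "\<delta> * \<gamma> = 1\<^sub>m r"
    using GL_A_inverse[OF \<gamma>] by metis
  have "\<alpha> = (\<alpha> * \<delta>) * \<gamma>"
    using \<alpha> \<delta> assoc_mult_mat[OF \<alpha> GL_A_carrier[OF \<delta>(1)] GL_A_carrier[OF \<gamma>]] by simp
  then show ?thesis
    unfolding right_dvd_def using mult_carrier_mat[OF \<alpha> GL_A_carrier[OF \<delta>(1)]] by blast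
qed

text \<open>Every matrix is right divisible by a unit, so \<open>slash_hecke\<close> with
  \<open>M = 1\<close> restricts nothing. Invariance is what permits Hecke operators to be
  iterated.\<close>

lemma invariant_hecke:
  assumes f: "invariant f" and N: "N \<noteq> 0"
  shows "invariant (hecke \<iota> r k N f)"
  unfolding invariant_def
proof (intro ballI)
  fix \<gamma> :: "'q poly mat" and \<omega> assume \<gamma>: "\<gamma> \<in> GL_A r" and \<omega>: "\<omega> \<in> Omega \<iota> r"
  have "slash r k (hecke \<iota> r k N f) (emb_mat \<gamma>) \<omega>
    = (\<Sum>C\<in>{C \<in> cosets r (N * 1). right_dvd r \<gamma> (rep C)}. slash r k f (emb_mat (rep C)) \<omega>)"
    using \<gamma> by (intro slash_hecke[OF f N _ _ \<omega>]) (simp_all add: GL_A_eq)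
  also have "{C \<in> cosets r (N * 1). right_dvd r \<gamma> (rep C)} = cosets r N"
    using right_dvd_GL_A[OF \<gamma> rep_carrier] by auto
  finally show "slash r k (hecke \<iota> r k N f) (emb_mat \<gamma>) \<omega> = hecke \<iota> r k N f \<omega>"
    unfolding hecke_eq[OF N, of f \<omega>] .
qed

lemma hecke_const:
  assumes f: "invariant f" and c: "c \<noteq> 0" and \<omega>: "\<omega> \<in> Omega \<iota> r"
  shows "hecke \<iota> r k [:c:] f \<omega> = f \<omega>"
proof -
  have cosets: "cosets r [:c:] = {GL_A r}"
    using cosets_smult[OF c, of r 1] by (simp add: cosets_one)
  have "rep (GL_A r :: 'q poly mat set) \<in> GL_A r"
    using rep_det_class[of "GL_A r" r 1] by (simp add: cosets_one GL_A_eq)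
  then show ?thesis
    using f c \<omega> by (simp add: hecke_eq cosets invariant_def)
qed

text \<open>Exchanging the two sums counts each coset of determinant \<open>N * p\<close> as often
  as it has right divisors of determinant \<open>p\<close>, which is once in
  \<open>'c\<close>.\<close>

lemma hecke_irreducible:
  assumes f: "invariant f" and p: "Factorial_Ring.irreducible p" and N: "N \<noteq> 0"
    and \<omega>: "\<omega> \<in> Omega \<iota> r"
  shows "hecke \<iota> r k p (hecke \<iota> r k N f) \<omega> = hecke \<iota> r k (p * N) f \<omega>"
proof -
  let ?F = "\<lambda>C. slash r k f (emb_mat (rep C)) \<omega>"
  have p0: "p \<noteq> 0" using p by auto
  have "hecke \<iota> r k p (hecke \<iota> r k N f) \<omega>
      = (\<Sum>B\<in>cosets r p. \<Sum>C\<in>{C \<in> cosets r (N * p). right_dvd r (rep B) (rep C)}. ?F C)"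
    unfolding hecke_eq[OF p0] by (intro sum.cong refl slash_hecke[OF f N p0 rep_det_class \<omega>])
  also have "\<dots> = (\<Sum>C\<in>cosets r (N * p). \<Sum>B\<in>{B \<in> cosets r p. right_dvd r (rep B) (rep C)}. ?F C)"
    using finite_cosets[of p r] finite_cosets[of "N * p" r] N p0 by (intro sum.swap_restrict) auto
  also have "\<dots> = (\<Sum>C\<in>cosets r (N * p). ?F C)"
  proof (rule sum.cong)
    fix C assume C: "C \<in> cosets r (N * p)"
    have "of_nat (card {B \<in> cosets r p. right_dvd r (rep B) (rep C)}) = (1 :: 'c)"
      using dvd_det_det_class[OF rep_det_class[OF C]]
      by (rule card_irreducible_right_divisors[OF p rep_carrier[OF C] _ of_nat_card_C])
    then show "(\<Sum>B\<in>{B \<in> cosets r p. right_dvd r (rep B) (rep C)}. ?F C) = ?F C"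
      by simp
  qed simp
  also have "\<dots> = hecke \<iota> r k (p * N) f \<omega>"
    using hecke_eq[of "p * N" f \<omega>] N p0 by (simp add: mult.commute)
  finally show ?thesis .
qed

lemma hecke_hecke:
  assumes M: "M \<noteq> 0" and "N \<noteq> 0" "invariant f" "\<omega> \<in> Omega \<iota> r"
  shows "hecke \<iota> r k M (hecke \<iota> r k N f) \<omega> = hecke \<iota> r k (M * N) f \<omega>"
  using assms
proof (induction M arbitrary: N f \<omega> rule: poly_mult_induct)
  case (const c)
  have "hecke \<iota> r k ([:c:] * N) f \<omega> = hecke \<iota> r k N f \<omega>"
    using const by (simp add: hecke_eq cosets_smult)
  then show ?case
    using const by (simp add: hecke_const invariant_hecke)
next
  case (irreducible p)
  then show ?case by (simp add: hecke_irreducible)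
next
  case (mult a b)
  \<comment> \<open>The hypothesis for \<open>a\<close> is read backwards with \<open>b\<close> in
    place of \<open>N\<close> and the invariant function \<open>hecke \<iota> r k N f\<close> in
    place of \<open>f\<close>, hence the generalisation over both.\<close>
  have "hecke \<iota> r k (a * b) (hecke \<iota> r k N f) \<omega> = hecke \<iota> r k a (hecke \<iota> r k b (hecke \<iota> r k N f)) \<omega>"
    using mult invariant_hecke by simp
  also have "\<dots> = hecke \<iota> r k a (hecke \<iota> r k (b * N) f) \<omega>"
    using mult by (intro hecke_cong) simp_all
  also have "\<dots> = hecke \<iota> r k (a * b * N) f \<omega>"
    using mult by (simp add: mult.assoc)
  finally show ?case .
qed

text \<open>The outermost operator is peeled off. The induction generalises \<open>\<omega>\<close>
  because \<open>hecke_cong\<close> needs the hypothesis on all of \<open>Omega\<close>.\<close>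

lemma hecke_power:
  assumes p: "p \<noteq> 0" and f: "invariant f" and \<omega>: "\<omega> \<in> Omega \<iota> r"
  shows "hecke \<iota> r k (p ^ Suc n) f \<omega> = (hecke \<iota> r k p ^^ Suc n) f \<omega>"
  using \<omega>
proof (induction n arbitrary: \<omega>)
  case (Suc n)
  have "(hecke \<iota> r k p ^^ Suc (Suc n)) f \<omega> = hecke \<iota> r k p (hecke \<iota> r k (p ^ Suc n) f) \<omega>"
    using Suc.IH Suc.prems p by (simp only: funpow.simps o_apply, intro hecke_cong) simp_all
  also have "\<dots> = hecke \<iota> r k (p ^ Suc (Suc n)) f \<omega>"
    using hecke_hecke[OF p _ f Suc.prems, of "p ^ Suc n"] p by simp
  finally show ?case by simp
qed simp

end

theorem theorem5p12:
  fixes \<iota> :: "'q::{finite, field} fls alg_closure \<Rightarrow> 'c::{field, complete_space}"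
    and r :: nat and k :: int
  assumes "C_infinity \<iota>" and "r \<ge> 2"
  shows "(\<forall>(M :: 'q poly) (N :: 'q poly) (f :: 'c vec \<Rightarrow> 'c).
            M \<noteq> 0 \<longrightarrow> N \<noteq> 0 \<longrightarrow> drinfeld_modular_form \<iota> r k f \<longrightarrow>
            (\<forall>\<omega>\<in>Omega \<iota> r.
               hecke \<iota> r k M (hecke \<iota> r k N f) \<omega> = hecke \<iota> r k (M * N) f \<omega>)) \<and>
         (\<forall>(p :: 'q poly) (n :: nat) (f :: 'c vec \<Rightarrow> 'c).
            Factorial_Ring.irreducible p \<longrightarrow> n \<ge> 1 \<longrightarrow> drinfeld_modular_form \<iota> r k f \<longrightarrow>
            (\<forall>\<omega>\<in>Omega \<iota> r.
               hecke \<iota> r k (p ^ n) f \<omega> = (hecke \<iota> r k p ^^ n) f \<omega>))"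
proof -
  interpret drinfeld_setting \<iota> r k
    using assms by (intro drinfeld_setting.intro) (auto simp: C_infinity_def)
  have invariant: "invariant f" if "drinfeld_modular_form \<iota> r k f" for f
    using that by (simp add: drinfeld_modular_form_def invariant_def)
  show ?thesis
  proof (intro conjI allI impI ballI)
    fix M N :: "'q poly" and f :: "'c vec \<Rightarrow> 'c" and \<omega>
    assume "M \<noteq> 0" "N \<noteq> 0" "drinfeld_modular_form \<iota> r k f" "\<omega> \<in> Omega \<iota> r"
    then show "hecke \<iota> r k M (hecke \<iota> r k N f) \<omega> = hecke \<iota> r k (M * N) f \<omega>"
      using hecke_hecke invariant by blast
  next
    fix p :: "'q poly" and n :: nat and f :: "'c vec \<Rightarrow> 'c" and \<omega>
    assume "Factorial_Ring.irreducible p" "n \<ge> 1" "drinfeld_modular_form \<iota> r k f" "\<omega> \<in> Omega \<iota> r"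
    then show "hecke \<iota> r k (p ^ n) f \<omega> = (hecke \<iota> r k p ^^ n) f \<omega>"
      using hecke_power[of p f \<omega> "n - 1"] invariant by auto
  qed
qed

end
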